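(* Let $p,q$ be distinct primes, let $G=C_{pq}$ be the cyclic group of order $pq$, and let $\mathcal{A}\in\mathcal{O}_G[\mathrm{DGA}]$ be a diagram of DGAs over the orbit category $\mathcal{O}_G$. If $\mathcal{A}$ satisfies Property I, then $\mathcal{A}$, regarded as an object of $Vec^*_G$, is injective.
   Context: All DGAs are commutative differential graded algebras over $\mathbb{Q}$. Orbit category: for a finite group $G$, $\mathcal{O}_G$ is the category whose objects are the $G$-sets $G/H$ ($H\le G$) and whose morphisms are $G$-maps. $\mathcal{O}_G[\mathrm{DGA}]$ is the category of diagrams of DGAs, i.e. covariant functors from $\mathcal{O}_G$ to cohomologically $1$-connected DGAs ($H^0=\mathbb{Q}$, $H^1=0$). $Vec^*_G$ is the category of dual rational coefficient systems, i.e. covariant functors from $\mathcal{O}_G$ to graded $\mathbb{Q}$-vector spaces. A diagram of DGAs is regarded as an object of $Vec^*_G$ by forgetting differential and multiplication. An object $I$ of a category is injective if for every injective morphism $f:X\to Y$ (for $Vec^*_G$: injective at every $G/H$) and every morphism $g:X\to I$ there is $h:Y\to I$ with $h\circ f=g$. Notation for $G=C_{pq}$: the subgroups are $e,P,Q,G$ of orders $1,p,q,pq$. For subgroups $H\subset K$ write $\mathcal{A}_{H,K}:\mathcal{A}(G/H)\to\mathcal{A}(G/K)$ for the structure map induced by the projection $G/H\to G/K$. Property I: let $\mathcal{K}=\{(a,b)\in\mathcal{A}(G/P)\times\mathcal{A}(G/Q): \mathcal{A}_{P,G}(a)=\mathcal{A}_{Q,G}(b)\}$ (formed degreewise) be the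 pullback of $\mathcal{A}(G/P)\xrightarrow{\mathcal{A}_{P,G}}\mathcal{A}(G/G)\xleftarrow{\mathcal{A}_{Q,G}}\mathcal{A}(G/Q)$, and let $\mathcal{A}_{\mathcal{K}}:\mathcal{A}(G/e)\to\mathcal{K}$, $x\mapsto(\mathcal{A}_{e,P}(x),\mathcal{A}_{e,Q}(x))$, be the map given by the universal property. $\mathcal{A}$ satisfies Property I if $\mathcal{A}_{P,G}$, $\mathcal{A}_{Q,G}$ and $\mathcal{A}_{\mathcal{K}}$ are all surjective as maps of vector spaces. *)

theory Defs
  imports "HOL-Algebra.Algebra" "HOL-Algebra.Algebraic_Closure_Type"
begin

section \<open>The orbit category\<close>

text \<open>
  An object of the orbit category is a \<open>G\<close>-set \<open>G/H\<close>, represented as the set of left cosets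
  of \<open>H\<close> with \<open>G\<close> acting by left translation.  Since \<open>H\<close> is the only element of \<open>G/H\<close>
  containing the unit, distinct subgroups give distinct objects.
\<close>

definition orbits :: "'g monoid \<Rightarrow> 'g set set set" where
  "orbits G = {lcosets\<^bsub>G\<^esub> H | H. subgroup H G}"

text \<open>
  Morphisms are extensional functions, so that equality of morphisms is equality in HOL;
  composition is \<^const>\<open>compose\<close>.
\<close>

definition G_maps :: "'g monoid \<Rightarrow> 'g set set \<Rightarrow> 'g set set \<Rightarrow> ('g set \<Rightarrow> 'g set) set" where
  "G_maps G S T =
     {\<phi> \<in> S \<rightarrow>\<^sub>E T. \<forall>g \<in> carrier G. \<forall>C \<in> S. \<phi> (g <#\<^bsub>G\<^esub> C) = g <#\<^bsub>G\<^esub> \<phi> C}"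

text \<open>For \<open>H \<subseteq> K\<close> this is the projection \<open>G/H \<rightarrow> G/K\<close>, because \<open>(gH)K = gK\<close>.\<close>

definition orbit_proj :: "'g monoid \<Rightarrow> 'g set \<Rightarrow> 'g set \<Rightarrow> 'g set \<Rightarrow> 'g set" where
  "orbit_proj G H K = (\<lambda>C \<in> lcosets\<^bsub>G\<^esub> H. C <#>\<^bsub>G\<^esub> K)"


section \<open>Graded rational vector spaces\<close>

abbreviation Rats_ring :: "rat ring" where
  "Rats_ring \<equiv> ring_of_type_algebra"

text \<open>
  Gradings are by the natural numbers.  The record type \<^typ>\<open>('a, 'b) module\<close> extends that of
  rings; its components \<^const>\<open>monoid.mult\<close> and \<^const>\<open>monoid.one\<close> are ignored by the locale
  \<^locale>\<open>module\<close> and are never used here.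
\<close>

type_synonym 'a graded = "nat \<Rightarrow> (rat, 'a) module"

definition graded_vs :: "'a graded \<Rightarrow> bool" where
  "graded_vs V \<longleftrightarrow> (\<forall>n. module Rats_ring (V n))"

definition linear_map ::
  "(rat, 'a) module \<Rightarrow> (rat, 'b) module \<Rightarrow> ('a \<Rightarrow> 'b) \<Rightarrow> bool" where
  "linear_map M N f \<longleftrightarrow>
     f \<in> carrier M \<rightarrow> carrier N \<and>
     (\<forall>x \<in> carrier M. \<forall>y \<in> carrier M. f (x \<oplus>\<^bsub>M\<^esub> y) = f x \<oplus>\<^bsub>N\<^esub> f y) \<and>
     (\<forall>c. \<forall>x \<in> carrier M. f (c \<odot>\<^bsub>M\<^esub> x) = c \<odot>\<^bsub>N\<^esub> f x)"


section \<open>Dual rational coefficient systems\<close>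

text \<open>
  \<open>cmor V S T \<phi> n\<close> is the degree \<open>n\<close> part of the map induced by \<open>\<phi> : S \<rightarrow> T\<close>.  Functions
  matter only on carriers, so maps are compared there.
\<close>

record ('g, 'a) coef =
  cob :: "'g set set \<Rightarrow> 'a graded"
  cmor :: "'g set set \<Rightarrow> 'g set set \<Rightarrow> ('g set \<Rightarrow> 'g set) \<Rightarrow> nat \<Rightarrow> 'a \<Rightarrow> 'a"

locale coef_system =
  fixes G :: "'g monoid" and V :: "('g, 'a) coef"
  assumes ob: "S \<in> orbits G \<Longrightarrow> graded_vs (cob V S)"
    and mor: "\<lbrakk>S \<in> orbits G; T \<in> orbits G; \<phi> \<in> G_maps G S T\<rbrakk>
      \<Longrightarrow> linear_map (cob V S n) (cob V T n) (cmor V S T \<phi> n)"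
    and mor_id: "\<lbrakk>S \<in> orbits G; x \<in> carrier (cob V S n)\<rbrakk>
      \<Longrightarrow> cmor V S S (\<lambda>C \<in> S. C) n x = x"
    and mor_comp: "\<lbrakk>S \<in> orbits G; T \<in> orbits G; U \<in> orbits G;
        \<phi> \<in> G_maps G S T; \<psi> \<in> G_maps G T U; x \<in> carrier (cob V S n)\<rbrakk>
      \<Longrightarrow> cmor V S U (compose S \<psi> \<phi>) n x = cmor V T U \<psi> n (cmor V S T \<phi> n x)"

definition coef_morphism ::
  "'g monoid \<Rightarrow> ('g, 'a) coef \<Rightarrow> ('g, 'b) coef \<Rightarrow> ('g set set \<Rightarrow> nat \<Rightarrow> 'a \<Rightarrow> 'b) \<Rightarrow> bool" where
  "coef_morphism G V W f \<longleftrightarrow>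
     (\<forall>S \<in> orbits G. \<forall>n. linear_map (cob V S n) (cob W S n) (f S n)) \<and>
     (\<forall>S \<in> orbits G. \<forall>T \<in> orbits G. \<forall>\<phi> \<in> G_maps G S T. \<forall>n. \<forall>x \<in> carrier (cob V S n).
        f T n (cmor V S T \<phi> n x) = cmor W S T \<phi> n (f S n x))"

definition coef_inj_morphism ::
  "'g monoid \<Rightarrow> ('g, 'a) coef \<Rightarrow> ('g, 'b) coef \<Rightarrow> ('g set set \<Rightarrow> nat \<Rightarrow> 'a \<Rightarrow> 'b) \<Rightarrow> bool" where
  "coef_inj_morphism G V W f \<longleftrightarrow>
     coef_morphism G V W f \<and> (\<forall>S \<in> orbits G. \<forall>n. inj_on (f S n) (carrier (cob V S n)))"

text \<open>
  HOL cannot quantify over types inside a formula.  The two type arguments name the types in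
  which the elements of the test systems \<open>V\<close> and \<open>W\<close> live; a theorem in which they are type
  variables speaks about all test systems.
\<close>

definition injective_coef ::
  "'x itself \<Rightarrow> 'y itself \<Rightarrow> 'g monoid \<Rightarrow> ('g, 'a) coef \<Rightarrow> bool" where
  "injective_coef _ _ G I \<longleftrightarrow>
     coef_system G I \<and>
     (\<forall>(V :: ('g, 'x) coef) (W :: ('g, 'y) coef) f g.
        coef_system G V \<and> coef_system G W \<and> coef_inj_morphism G V W f \<and> coef_morphism G V I g
        \<longrightarrow> (\<exists>h. coef_morphism G W I h \<and>
               (\<forall>S \<in> orbits G. \<forall>n. \<forall>x \<in> carrier (cob V S n). h S n (f S n x) = g S n x)))"


section \<open>Commutative differential graded algebras over the rationals\<close>

text \<open>
  \<open>dmul A m n\<close> is the product of an element of degree \<open>m\<close> with one of degree \<open>n\<close>, and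
  \<open>ddiff A n\<close> is the differential from degree \<open>n\<close> to degree \<open>n + 1\<close>.
\<close>

record 'a dga =
  gr :: "'a graded"
  dmul :: "nat \<Rightarrow> nat \<Rightarrow> 'a \<Rightarrow> 'a \<Rightarrow> 'a"
  dunit :: "'a"
  ddiff :: "nat \<Rightarrow> 'a \<Rightarrow> 'a"

locale cdga =
  fixes A :: "'a dga"
  assumes graded: "graded_vs (gr A)"
    and mul_linear_right: "x \<in> carrier (gr A m)
      \<Longrightarrow> linear_map (gr A n) (gr A (m + n)) (\<lambda>y. dmul A m n x y)"
    and mul_linear_left: "y \<in> carrier (gr A n)
      \<Longrightarrow> linear_map (gr A m) (gr A (m + n)) (\<lambda>x. dmul A m n x y)"
    and mul_assoc: "\<lbrakk>x \<in> carrier (gr A l); y \<in> carrier (gr A m); z \<in> carrier (gr A n)\<rbrakk>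
      \<Longrightarrow> dmul A (l + m) n (dmul A l m x y) z = dmul A l (m + n) x (dmul A m n y z)"
    and unit_closed: "dunit A \<in> carrier (gr A 0)"
    and mul_unit_left: "x \<in> carrier (gr A n) \<Longrightarrow> dmul A 0 n (dunit A) x = x"
    and mul_unit_right: "x \<in> carrier (gr A n) \<Longrightarrow> dmul A n 0 x (dunit A) = x"
    and mul_commute: "\<lbrakk>x \<in> carrier (gr A m); y \<in> carrier (gr A n)\<rbrakk>
      \<Longrightarrow> dmul A m n x y = (-1) ^ (m * n) \<odot>\<^bsub>gr A (m + n)\<^esub> dmul A n m y x"
    and diff_linear: "linear_map (gr A n) (gr A (Suc n)) (ddiff A n)"
    and diff_diff: "x \<in> carrier (gr A n)
      \<Longrightarrow> ddiff A (Suc n) (ddiff A n x) = \<zero>\<^bsub>gr A (Suc (Suc n))\<^esub>"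
    and leibniz: "\<lbrakk>x \<in> carrier (gr A m); y \<in> carrier (gr A n)\<rbrakk>
      \<Longrightarrow> ddiff A (m + n) (dmul A m n x y) =
            dmul A (Suc m) n (ddiff A m x) y
              \<oplus>\<^bsub>gr A (Suc (m + n))\<^esub> (-1) ^ m \<odot>\<^bsub>gr A (Suc (m + n))\<^esub> dmul A m (Suc n) x (ddiff A n y)"

definition cdga_morphism :: "'a dga \<Rightarrow> 'b dga \<Rightarrow> (nat \<Rightarrow> 'a \<Rightarrow> 'b) \<Rightarrow> bool" where
  "cdga_morphism A B f \<longleftrightarrow>
     (\<forall>n. linear_map (gr A n) (gr B n) (f n)) \<and>
     (\<forall>m n. \<forall>x \<in> carrier (gr A m). \<forall>y \<in> carrier (gr A n).
        f (m + n) (dmul A m n x y) = dmul B m n (f m x) (f n y)) \<and>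
     f 0 (dunit A) = dunit B \<and>
     (\<forall>n. \<forall>x \<in> carrier (gr A n). f (Suc n) (ddiff A n x) = ddiff B n (f n x))"

definition cocycles :: "'a dga \<Rightarrow> nat \<Rightarrow> 'a set" where
  "cocycles A n = {x \<in> carrier (gr A n). ddiff A n x = \<zero>\<^bsub>gr A (Suc n)\<^esub>}"

definition coboundaries :: "'a dga \<Rightarrow> nat \<Rightarrow> 'a set" where
  "coboundaries A n =
     (case n of 0 \<Rightarrow> {\<zero>\<^bsub>gr A 0\<^esub>} | Suc m \<Rightarrow> ddiff A m ` carrier (gr A m))"

definition cohomology_class :: "'a dga \<Rightarrow> nat \<Rightarrow> 'a \<Rightarrow> 'a set" where
  "cohomology_class A n x = coboundaries A n +>\<^bsub>gr A n\<^esub> x"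

definition cohomology :: "'a dga \<Rightarrow> nat \<Rightarrow> 'a set set" where
  "cohomology A n = cohomology_class A n ` cocycles A n"

text \<open>
  \<open>H\<^sup>0 = \<rat>\<close> means that the unit map, which sends a rational \<open>c\<close> to the class of \<open>c \<cdot> 1\<close>,
  is an isomorphism onto \<open>H\<^sup>0\<close>; in particular the algebra is nonzero.
\<close>

definition cohomologically_1_connected :: "'a dga \<Rightarrow> bool" where
  "cohomologically_1_connected A \<longleftrightarrow>
     bij_betw (\<lambda>c. cohomology_class A 0 (c \<odot>\<^bsub>gr A 0\<^esub> dunit A)) UNIV (cohomology A 0) \<and>
     cohomology A 1 = {cohomology_class A 1 \<zero>\<^bsub>gr A 1\<^esub>}"


section \<open>Diagrams of DGAs\<close>

record ('g, 'a) diagram =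
  dob :: "'g set set \<Rightarrow> 'a dga"
  dmor :: "'g set set \<Rightarrow> 'g set set \<Rightarrow> ('g set \<Rightarrow> 'g set) \<Rightarrow> nat \<Rightarrow> 'a \<Rightarrow> 'a"

locale dga_diagram =
  fixes G :: "'g monoid" and A :: "('g, 'a) diagram"
  assumes ob: "S \<in> orbits G \<Longrightarrow> cdga (dob A S)"
    and connected: "S \<in> orbits G \<Longrightarrow> cohomologically_1_connected (dob A S)"
    and mor: "\<lbrakk>S \<in> orbits G; T \<in> orbits G; \<phi> \<in> G_maps G S T\<rbrakk>
      \<Longrightarrow> cdga_morphism (dob A S) (dob A T) (dmor A S T \<phi>)"
    and mor_id: "\<lbrakk>S \<in> orbits G; x \<in> carrier (gr (dob A S) n)\<rbrakk>
      \<Longrightarrow> dmor A S S (\<lambda>C \<in> S. C) n x = x"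
    and mor_comp: "\<lbrakk>S \<in> orbits G; T \<in> orbits G; U \<in> orbits G;
        \<phi> \<in> G_maps G S T; \<psi> \<in> G_maps G T U; x \<in> carrier (gr (dob A S) n)\<rbrakk>
      \<Longrightarrow> dmor A S U (compose S \<psi> \<phi>) n x = dmor A T U \<psi> n (dmor A S T \<phi> n x)"

definition forget :: "('g, 'a) diagram \<Rightarrow> ('g, 'a) coef" where
  "forget A = \<lparr>cob = (\<lambda>S. gr (dob A S)), cmor = dmor A\<rparr>"

text \<open>The degree \<open>n\<close> parts of \<open>\<A>(G/H)\<close> and of \<open>\<A>\<^bsub>H,K\<^esub> : \<A>(G/H) \<rightarrow> \<A>(G/K)\<close>.\<close>

definition at_orbit :: "'g monoid \<Rightarrow> ('g, 'a) diagram \<Rightarrow> 'g set \<Rightarrow> nat \<Rightarrow> 'a set" where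
  "at_orbit G A H n = carrier (gr (dob A (lcosets\<^bsub>G\<^esub> H)) n)"

definition structure_map ::
  "'g monoid \<Rightarrow> ('g, 'a) diagram \<Rightarrow> 'g set \<Rightarrow> 'g set \<Rightarrow> nat \<Rightarrow> 'a \<Rightarrow> 'a" where
  "structure_map G A H K = dmor A (lcosets\<^bsub>G\<^esub> H) (lcosets\<^bsub>G\<^esub> K) (orbit_proj G H K)"


section \<open>Property I\<close>

definition pullback_K ::
  "'g monoid \<Rightarrow> 'g set \<Rightarrow> 'g set \<Rightarrow> ('g, 'a) diagram \<Rightarrow> nat \<Rightarrow> ('a \<times> 'a) set" where
  "pullback_K G P Q A n =
     {(a, b) \<in> at_orbit G A P n \<times> at_orbit G A Q n.
        structure_map G A P (carrier G) n a = structure_map G A Q (carrier G) n b}"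

definition map_to_K ::
  "'g monoid \<Rightarrow> 'g set \<Rightarrow> 'g set \<Rightarrow> ('g, 'a) diagram \<Rightarrow> nat \<Rightarrow> 'a \<Rightarrow> 'a \<times> 'a" where
  "map_to_K G P Q A n x =
     (structure_map G A {\<one>\<^bsub>G\<^esub>} P n x, structure_map G A {\<one>\<^bsub>G\<^esub>} Q n x)"

definition property_I ::
  "'g monoid \<Rightarrow> 'g set \<Rightarrow> 'g set \<Rightarrow> ('g, 'a) diagram \<Rightarrow> bool" where
  "property_I G P Q A \<longleftrightarrow>
     (\<forall>n. structure_map G A P (carrier G) n ` at_orbit G A P n = at_orbit G A (carrier G) n \<and>
          structure_map G A Q (carrier G) n ` at_orbit G A Q n = at_orbit G A (carrier G) n \<and>
          map_to_K G P Q A n ` at_orbit G A {\<one>\<^bsub>G\<^esub>} n = pullback_K G P Q A n)"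

end

theory Submission
  imports Defs
begin

text \<open>
  Because \<open>G\<close> is commutative, every \<open>G\<close>-map \<open>G/H \<rightarrow> G/K\<close> is a projection followed by a translation.
  The only subgroups are \<open>e\<close>, \<open>P\<close>, \<open>Q\<close> and \<open>G\<close>, so a morphism of coefficient systems amounts to four
  linear maps that commute with translations and with the projections in the square
  \<open>G/e \<rightarrow> G/P, G/Q \<rightarrow> G/G\<close>.

  To extend \<open>g : V \<rightarrow> A\<close> along an injection \<open>f : V \<rightarrow> W\<close> one goes through this square against the arrows.
  At \<open>G/G\<close> any equivariant linear extension will do.  At \<open>G/P\<close> the extension must in addition lift a map
  to \<open>A(G/G)\<close> that is already determined, and likewise at \<open>G/Q\<close>.  At \<open>G/e\<close> it must lift a map
  to the pullback of \<open>A(G/P)\<close> and \<open>A(G/Q)\<close> over \<open>A(G/G)\<close>.  Property I says exactly that the maps through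
  which one has to lift are surjective, so every single vector has a suitable image.

  It remains to choose these images linearly, equivariantly and with the values on \<open>f(V)\<close> that \<open>g\<close>
  dictates.  All requirements other than equivariance say that the graph lies in a given
  subspace and contains another one; linear algebra over a field then gives a linear choice
  (\<open>linear_selection\<close>), and averaging over the finite group \<open>G\<close>, with rational scalars,
  makes it equivariant (\<open>equivariant_selection\<close>).  One step of the construction is
  \<open>extension_step\<close>; the three steps are put together in
  \<open>extension_if_two_intermediate_subgroups\<close>.
\<close>

section \<open>Rational vector spaces and linear maps\<close>

lemma Rats_ring_simps [simp]:
  "carrier Rats_ring = UNIV" "a \<oplus>\<^bsub>Rats_ring\<^esub> b = a + b" "a \<otimes>\<^bsub>Rats_ring\<^esub> b = a * b"
  "\<one>\<^bsub>Rats_ring\<^esub> = 1" "\<zero>\<^bsub>Rats_ring\<^esub> = 0"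
  by (simp_all add: ring_of_type_algebra_def)

locale rat_space = module Rats_ring M for M :: "(rat, 'a) module" (structure)
begin

lemma scale_closed [simp, intro]: "x \<in> carrier M \<Longrightarrow> c \<odot> x \<in> carrier M"
  using smult_closed[of c x] by simp

lemma scale_left_distrib: "x \<in> carrier M \<Longrightarrow> (c + d) \<odot> x = c \<odot> x \<oplus> d \<odot> x"
  using smult_l_distr[of c d x] by simp

lemma scale_right_distrib:
  "\<lbrakk>x \<in> carrier M; y \<in> carrier M\<rbrakk> \<Longrightarrow> c \<odot> (x \<oplus> y) = c \<odot> x \<oplus> c \<odot> y"
  using smult_r_distr[of c x y] by simp

lemma scale_scale: "x \<in> carrier M \<Longrightarrow> c \<odot> (d \<odot> x) = (c * d) \<odot> x"
  using smult_assoc1[of c d x] by simp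

lemma scale_one [simp]: "x \<in> carrier M \<Longrightarrow> 1 \<odot> x = x"
  using smult_one[of x] by simp

lemma scale_zero_left [simp]: "x \<in> carrier M \<Longrightarrow> 0 \<odot> x = \<zero>"
  using smult_l_null[of x] by simp

lemma scale_zero_right [simp]: "c \<odot> \<zero> = \<zero>"
  using smult_r_null[of c] by simp

lemma minus_cancel: "x \<in> carrier M \<Longrightarrow> x \<oplus> (-1) \<odot> x = \<zero>"
  using scale_left_distrib[of x 1 "-1"] by simp

lemma eq_if_diff_zero:
  assumes "x \<in> carrier M" "y \<in> carrier M" "x \<oplus> (-1) \<odot> y = \<zero>"
  shows "x = y"
proof -
  have "y = (x \<oplus> (-1) \<odot> y) \<oplus> y"
    using assms by simp
  also have "\<dots> = x \<oplus> (y \<oplus> (-1) \<odot> y)"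
    using assms(1,2) by (simp add: a_ac)
  finally show ?thesis
    using assms(1,2) by (simp add: minus_cancel)
qed

lemma finsum_const_scale:
  assumes "finite A" "x \<in> carrier M"
  shows "(\<Oplus>a\<in>A. x) = of_nat (card A) \<odot> x"
  using assms(1)
proof induction
  case (insert a A)
  then show ?case
    using assms(2) by (simp add: finsum_insert scale_left_distrib)
qed (simp add: assms(2))

end

lemma graded_vsD: "graded_vs V \<Longrightarrow> rat_space (V n)"
  by (simp add: graded_vs_def rat_space_def)

lemma linear_map_closed: "\<lbrakk>linear_map M N f; x \<in> carrier M\<rbrakk> \<Longrightarrow> f x \<in> carrier N"
  by (auto simp: linear_map_def)

lemma linear_map_add:
  "\<lbrakk>linear_map M N f; x \<in> carrier M; y \<in> carrier M\<rbrakk> \<Longrightarrow> f (x \<oplus>\<^bsub>M\<^esub> y) = f x \<oplus>\<^bsub>N\<^esub> f y"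
  by (auto simp: linear_map_def)

lemma linear_map_scale:
  "\<lbrakk>linear_map M N f; x \<in> carrier M\<rbrakk> \<Longrightarrow> f (c \<odot>\<^bsub>M\<^esub> x) = c \<odot>\<^bsub>N\<^esub> f x"
  by (auto simp: linear_map_def)

lemma linear_map_zero:
  assumes "rat_space M" "rat_space N" "linear_map M N f"
  shows "f \<zero>\<^bsub>M\<^esub> = \<zero>\<^bsub>N\<^esub>"
proof -
  interpret M: rat_space M by fact
  interpret N: rat_space N by fact
  show ?thesis
    using linear_map_scale[OF assms(3), of "\<zero>\<^bsub>M\<^esub>" 0] linear_map_closed[OF assms(3), of "\<zero>\<^bsub>M\<^esub>"]
    by simp
qed

section \<open>Linear relations and linear selections\<close>

text \<open>
  Linear relations are the subspaces of \<open>M \<times> N\<close>.  They serve both for partially defined linear maps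
  and for the linear constraints that a map under construction has to obey.
\<close>

definition linear_relation ::
  "(rat, 'a) module \<Rightarrow> (rat, 'b) module \<Rightarrow> ('a \<times> 'b) set \<Rightarrow> bool" where
  "linear_relation M N L \<longleftrightarrow>
     L \<subseteq> carrier M \<times> carrier N \<and> (\<zero>\<^bsub>M\<^esub>, \<zero>\<^bsub>N\<^esub>) \<in> L \<and>
     (\<forall>x y x' y'. (x, y) \<in> L \<longrightarrow> (x', y') \<in> L \<longrightarrow> (x \<oplus>\<^bsub>M\<^esub> x', y \<oplus>\<^bsub>N\<^esub> y') \<in> L) \<and>
     (\<forall>c x y. (x, y) \<in> L \<longrightarrow> (c \<odot>\<^bsub>M\<^esub> x, c \<odot>\<^bsub>N\<^esub> y) \<in> L)"

lemma linear_relation_carrier: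
  "\<lbrakk>linear_relation M N L; (x, y) \<in> L\<rbrakk> \<Longrightarrow> x \<in> carrier M \<and> y \<in> carrier N"
  by (auto simp: linear_relation_def)

lemma linear_relation_zero: "linear_relation M N L \<Longrightarrow> (\<zero>\<^bsub>M\<^esub>, \<zero>\<^bsub>N\<^esub>) \<in> L"
  by (auto simp: linear_relation_def)

lemma linear_relation_add:
  "\<lbrakk>linear_relation M N L; (x, y) \<in> L; (x', y') \<in> L\<rbrakk> \<Longrightarrow> (x \<oplus>\<^bsub>M\<^esub> x', y \<oplus>\<^bsub>N\<^esub> y') \<in> L"
  by (auto simp: linear_relation_def)

lemma linear_relation_scale:
  "\<lbrakk>linear_relation M N L; (x, y) \<in> L\<rbrakk> \<Longrightarrow> (c \<odot>\<^bsub>M\<^esub> x, c \<odot>\<^bsub>N\<^esub> y) \<in> L"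
  by (auto simp: linear_relation_def)

lemma linear_relation_unique:
  assumes "rat_space M" "rat_space N" and L: "linear_relation M N L"
    and sv: "\<And>z. (\<zero>\<^bsub>M\<^esub>, z) \<in> L \<Longrightarrow> z = \<zero>\<^bsub>N\<^esub>"
    and "(x, y) \<in> L" "(x, y') \<in> L"
  shows "y = y'"
proof -
  interpret M: rat_space M by fact
  interpret N: rat_space N by fact
  have "(x \<oplus>\<^bsub>M\<^esub> (-1) \<odot>\<^bsub>M\<^esub> x, y \<oplus>\<^bsub>N\<^esub> (-1) \<odot>\<^bsub>N\<^esub> y') \<in> L"
    using assms by (intro linear_relation_add[OF L] linear_relation_scale[OF L])
  then show ?thesis
    using sv linear_relation_carrier[OF L] assms(5,6) N.eq_if_diff_zero M.minus_cancel by metis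
qed

lemma linear_relation_chain_Union:
  assumes "\<C> \<noteq> {}" "subset.chain {R. linear_relation M N R} \<C>"
  shows "linear_relation M N (\<Union>\<C>)"
proof -
  have lin: "linear_relation M N R" if "R \<in> \<C>" for R
    using assms(2) that by (auto simp: subset.chain_def)
  have common: "\<exists>R\<in>\<C>. p \<in> R \<and> p' \<in> R" if "p \<in> \<Union>\<C>" "p' \<in> \<Union>\<C>" for p p'
  proof -
    obtain R R' where "R \<in> \<C>" "R' \<in> \<C>" "p \<in> R" "p' \<in> R'"
      using \<open>p \<in> \<Union>\<C>\<close> \<open>p' \<in> \<Union>\<C>\<close> by blast
    moreover have "R \<subseteq> R' \<or> R' \<subseteq> R"
      using assms(2) \<open>R \<in> \<C>\<close> \<open>R' \<in> \<C>\<close> unfolding subset.chain_def by blast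
    ultimately show ?thesis by blast
  qed
  show ?thesis
    unfolding linear_relation_def
  proof (intro conjI allI impI)
    show "\<Union>\<C> \<subseteq> carrier M \<times> carrier N"
      using lin by (intro Union_least) (simp add: linear_relation_def)
    show "(\<zero>\<^bsub>M\<^esub>, \<zero>\<^bsub>N\<^esub>) \<in> \<Union>\<C>"
      using assms(1) lin linear_relation_zero by blast
  next
    fix x y x' y' assume "(x, y) \<in> \<Union>\<C>" "(x', y') \<in> \<Union>\<C>"
    then obtain R where "R \<in> \<C>" "(x, y) \<in> R" "(x', y') \<in> R"
      using common by blast
    then show "(x \<oplus>\<^bsub>M\<^esub> x', y \<oplus>\<^bsub>N\<^esub> y') \<in> \<Union>\<C>"
      using linear_relation_add[OF lin[OF \<open>R \<in> \<C>\<close>]] by (intro UnionI[of R])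
  next
    fix c x y assume "(x, y) \<in> \<Union>\<C>"
    then obtain R where "R \<in> \<C>" "(x, y) \<in> R"
      by blast
    then show "(c \<odot>\<^bsub>M\<^esub> x, c \<odot>\<^bsub>N\<^esub> y) \<in> \<Union>\<C>"
      using linear_relation_scale[OF lin[OF \<open>R \<in> \<C>\<close>]] by (intro UnionI[of R])
  qed
qed

text \<open>
  One step of the extension of a partial linear map by the value \<open>m\<close> at a new vector \<open>y\<close>: the span
  of \<open>R\<close> and \<open>(y, m)\<close>.
\<close>

lemma linear_relation_adjoin:
  assumes "rat_space M" "rat_space N" and R: "linear_relation M N R"
    and y: "y \<in> carrier M" and m: "m \<in> carrier N"
  defines "R' \<equiv> {(u \<oplus>\<^bsub>M\<^esub> c \<odot>\<^bsub>M\<^esub> y, v \<oplus>\<^bsub>N\<^esub> c \<odot>\<^bsub>N\<^esub> m) | u v c. (u, v) \<in> R}"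
  shows "linear_relation M N R'" "R \<subseteq> R'" "(y, m) \<in> R'"
proof -
  interpret M: rat_space M by fact
  interpret N: rat_space N by fact
  note carr = linear_relation_carrier[OF R]
  have R'I: "(a, b) \<in> R'"
    if "(u, v) \<in> R" "a = u \<oplus>\<^bsub>M\<^esub> c \<odot>\<^bsub>M\<^esub> y" "b = v \<oplus>\<^bsub>N\<^esub> c \<odot>\<^bsub>N\<^esub> m" for a b u v c
    using that unfolding R'_def by blast
  have zero: "(\<zero>\<^bsub>M\<^esub>, \<zero>\<^bsub>N\<^esub>) \<in> R"
    by (rule linear_relation_zero[OF R])
  show sub: "R \<subseteq> R'"
  proof clarify
    fix u v assume uv: "(u, v) \<in> R"
    show "(u, v) \<in> R'"
      by (rule R'I[OF uv, of _ 0]) (use carr[OF uv] y m in auto)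
  qed
  show "(y, m) \<in> R'"
    by (rule R'I[OF zero, of _ 1]) (use y m in auto)
  show "linear_relation M N R'"
    unfolding linear_relation_def
  proof (intro conjI allI impI)
    show "R' \<subseteq> carrier M \<times> carrier N"
      using carr y m unfolding R'_def by auto
    show "(\<zero>\<^bsub>M\<^esub>, \<zero>\<^bsub>N\<^esub>) \<in> R'"
      using zero sub by blast
  next
    fix a b a' b' assume "(a, b) \<in> R'" "(a', b') \<in> R'"
    then obtain u v c u' v' c' where
      *: "(u, v) \<in> R" "a = u \<oplus>\<^bsub>M\<^esub> c \<odot>\<^bsub>M\<^esub> y" "b = v \<oplus>\<^bsub>N\<^esub> c \<odot>\<^bsub>N\<^esub> m"
      "(u', v') \<in> R" "a' = u' \<oplus>\<^bsub>M\<^esub> c' \<odot>\<^bsub>M\<^esub> y" "b' = v' \<oplus>\<^bsub>N\<^esub> c' \<odot>\<^bsub>N\<^esub> m"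
      unfolding R'_def by blast
    have "a \<oplus>\<^bsub>M\<^esub> a' = (u \<oplus>\<^bsub>M\<^esub> u') \<oplus>\<^bsub>M\<^esub> (c + c') \<odot>\<^bsub>M\<^esub> y"
      using carr[OF *(1)] carr[OF *(4)] y unfolding *(2,5)
      by (simp add: M.scale_left_distrib M.a_ac)
    moreover have "b \<oplus>\<^bsub>N\<^esub> b' = (v \<oplus>\<^bsub>N\<^esub> v') \<oplus>\<^bsub>N\<^esub> (c + c') \<odot>\<^bsub>N\<^esub> m"
      using carr[OF *(1)] carr[OF *(4)] m unfolding *(3,6)
      by (simp add: N.scale_left_distrib N.a_ac)
    ultimately show "(a \<oplus>\<^bsub>M\<^esub> a', b \<oplus>\<^bsub>N\<^esub> b') \<in> R'"
      using R'I linear_relation_add[OF R *(1) *(4)] by blast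
  next
    fix d a b assume "(a, b) \<in> R'"
    then obtain u v c where
      *: "(u, v) \<in> R" "a = u \<oplus>\<^bsub>M\<^esub> c \<odot>\<^bsub>M\<^esub> y" "b = v \<oplus>\<^bsub>N\<^esub> c \<odot>\<^bsub>N\<^esub> m"
      unfolding R'_def by blast
    have "d \<odot>\<^bsub>M\<^esub> a = d \<odot>\<^bsub>M\<^esub> u \<oplus>\<^bsub>M\<^esub> (d * c) \<odot>\<^bsub>M\<^esub> y"
      using carr[OF *(1)] y unfolding *(2) by (simp add: M.scale_right_distrib M.scale_scale)
    moreover have "d \<odot>\<^bsub>N\<^esub> b = d \<odot>\<^bsub>N\<^esub> v \<oplus>\<^bsub>N\<^esub> (d * c) \<odot>\<^bsub>N\<^esub> m"
      using carr[OF *(1)] m unfolding *(3) by (simp add: N.scale_right_distrib N.scale_scale)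
    ultimately show "(d \<odot>\<^bsub>M\<^esub> a, d \<odot>\<^bsub>N\<^esub> b) \<in> R'"
      using R'I linear_relation_scale[OF R *(1)] by blast
  qed
qed

text \<open>
  Over a field there is no obstruction to choosing values linearly.  The relation \<open>L\<close> collects the values that are allowed, and \<open>R0\<close> prescribes some of them.
  By Zorn's lemma there is a maximal single-valued linear relation between \<open>R0\<close> and \<open>L\<close>; if it
  missed a vector \<open>y\<close>, an allowed value at \<open>y\<close> could be adjoined.  The extension of linear maps from
  subspaces and their lifting through surjections are both special cases, and so is extension with
  simultaneous lifting through several maps.
\<close>

lemma linear_selection:
  assumes M: "rat_space M" and N: "rat_space N"
    and L: "linear_relation M N L" and total: "carrier M \<subseteq> Domain L"
    and R0: "linear_relation M N R0" "R0 \<subseteq> L"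
    and sv: "\<And>z. (\<zero>\<^bsub>M\<^esub>, z) \<in> R0 \<Longrightarrow> z = \<zero>\<^bsub>N\<^esub>"
  obtains h where "linear_map M N h" "\<And>y. y \<in> carrier M \<Longrightarrow> (y, h y) \<in> L"
    "\<And>y z. (y, z) \<in> R0 \<Longrightarrow> h y = z"
proof -
  interpret M: rat_space M by fact
  interpret N: rat_space N by fact
  define \<A> where "\<A> = {R. linear_relation M N R \<and> R0 \<subseteq> R \<and> R \<subseteq> L \<and>
    (\<forall>z. (\<zero>\<^bsub>M\<^esub>, z) \<in> R \<longrightarrow> z = \<zero>\<^bsub>N\<^esub>)}"
  have "\<exists>R\<in>\<A>. \<forall>S\<in>\<A>. R \<subseteq> S \<longrightarrow> S = R"
  proof (rule subset_Zorn_nonempty)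
    have "R0 \<in> \<A>"
      using R0 sv by (auto simp: \<A>_def)
    then show "\<A> \<noteq> {}" by blast
  next
    fix \<C> assume \<C>: "\<C> \<noteq> {}" "subset.chain \<A> \<C>"
    then have "subset.chain {R. linear_relation M N R} \<C>"
      by (auto simp: subset.chain_def \<A>_def)
    with \<C>(1) have "linear_relation M N (\<Union>\<C>)"
      by (rule linear_relation_chain_Union)
    moreover have mem: "R0 \<subseteq> R \<and> R \<subseteq> L \<and> (\<forall>z. (\<zero>\<^bsub>M\<^esub>, z) \<in> R \<longrightarrow> z = \<zero>\<^bsub>N\<^esub>)" if "R \<in> \<C>" for R
      using \<C>(2) that by (auto simp: subset.chain_def \<A>_def)
    have "R0 \<subseteq> \<Union>\<C>"
      using \<C>(1) mem by blast
    moreover have "\<Union>\<C> \<subseteq> L"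
      using mem by (intro Union_least) simp
    moreover have "\<forall>z. (\<zero>\<^bsub>M\<^esub>, z) \<in> \<Union>\<C> \<longrightarrow> z = \<zero>\<^bsub>N\<^esub>"
      using mem by (meson UnionE)
    ultimately show "\<Union>\<C> \<in> \<A>"
      unfolding \<A>_def by simp
  qed
  then obtain R where "R \<in> \<A>" and maximal: "\<And>S. \<lbrakk>S \<in> \<A>; R \<subseteq> S\<rbrakk> \<Longrightarrow> S = R"
    by blast
  then have R: "linear_relation M N R" "R0 \<subseteq> R" "R \<subseteq> L"
    "\<And>z. (\<zero>\<^bsub>M\<^esub>, z) \<in> R \<Longrightarrow> z = \<zero>\<^bsub>N\<^esub>"
    by (auto simp: \<A>_def)
  note carr = linear_relation_carrier[OF R(1)]
  have R_total: "\<exists>z. (y, z) \<in> R" if y: "y \<in> carrier M" for y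
  proof (rule ccontr)
    assume undef: "\<nexists>z. (y, z) \<in> R"
    obtain m where m: "(y, m) \<in> L"
      using total y by blast
    then have "m \<in> carrier N"
      using linear_relation_carrier[OF L] by blast
    define R' where "R' = {(u \<oplus>\<^bsub>M\<^esub> c \<odot>\<^bsub>M\<^esub> y, v \<oplus>\<^bsub>N\<^esub> c \<odot>\<^bsub>N\<^esub> m) | u v c. (u, v) \<in> R}"
    note R' = linear_relation_adjoin[OF M N R(1) y \<open>m \<in> carrier N\<close>, folded R'_def]
    have "R' \<subseteq> L"
    proof
      fix w assume "w \<in> R'"
      then obtain u v c where "(u, v) \<in> R" "w = (u \<oplus>\<^bsub>M\<^esub> c \<odot>\<^bsub>M\<^esub> y, v \<oplus>\<^bsub>N\<^esub> c \<odot>\<^bsub>N\<^esub> m)"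
        unfolding R'_def by blast
      moreover have "(u, v) \<in> L"
        using R(3) \<open>(u, v) \<in> R\<close> by blast
      ultimately show "w \<in> L"
        using linear_relation_add[OF L _ linear_relation_scale[OF L m]] by simp
    qed
    moreover have "z = \<zero>\<^bsub>N\<^esub>" if "(\<zero>\<^bsub>M\<^esub>, z) \<in> R'" for z
    proof -
      obtain u v c where uvc: "(u, v) \<in> R" "u \<oplus>\<^bsub>M\<^esub> c \<odot>\<^bsub>M\<^esub> y = \<zero>\<^bsub>M\<^esub>" "z = v \<oplus>\<^bsub>N\<^esub> c \<odot>\<^bsub>N\<^esub> m"
        using \<open>(\<zero>\<^bsub>M\<^esub>, z) \<in> R'\<close> unfolding R'_def by auto
      \<comment> \<open>Otherwise \<open>y\<close> would be a multiple of \<open>u\<close>, hence in the domain of \<open>R\<close>.\<close>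
      have "c = 0"
      proof (rule ccontr)
        assume "c \<noteq> 0"
        then have "u \<oplus>\<^bsub>M\<^esub> (-1) \<odot>\<^bsub>M\<^esub> ((- c) \<odot>\<^bsub>M\<^esub> y) = \<zero>\<^bsub>M\<^esub>"
          using uvc(2) y by (simp add: M.scale_scale)
        then have "u = (- c) \<odot>\<^bsub>M\<^esub> y"
          using M.eq_if_diff_zero carr[OF uvc(1)] y by blast
        then have "(- 1 / c) \<odot>\<^bsub>M\<^esub> u = y"
          using \<open>c \<noteq> 0\<close> y by (simp add: M.scale_scale)
        then show False
          using linear_relation_scale[OF R(1) uvc(1), of "- 1 / c"] undef by auto
      qed
      then show ?thesis
        using uvc R(4)[of v] carr[OF uvc(1)] y \<open>m \<in> carrier N\<close> by simp
    qed
    ultimately have "R' \<in> \<A>"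
      using R' R(2) by (auto simp: \<A>_def)
    then have "R' = R"
      using maximal R' by blast
    then show False
      using R' undef by blast
  qed
  define h where "h y = (SOME z. (y, z) \<in> R)" for y
  have h: "(y, h y) \<in> R" if "y \<in> carrier M" for y
    unfolding h_def using R_total[OF that] by (rule someI_ex)
  have h_eq: "h y = z" if "(y, z) \<in> R" for y z
    by (rule linear_relation_unique[OF M N R(1) R(4) h that]) (use carr[OF that] in simp_all)
  show thesis
  proof (rule that)
    show "linear_map M N h"
      unfolding linear_map_def
    proof (intro conjI ballI allI)
      show "h \<in> carrier M \<rightarrow> carrier N"
        using h carr by blast
      show "h (x \<oplus>\<^bsub>M\<^esub> y) = h x \<oplus>\<^bsub>N\<^esub> h y" if "x \<in> carrier M" "y \<in> carrier M" for x y
        by (rule h_eq[OF linear_relation_add[OF R(1)]]) (use h that in auto)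
      show "h (c \<odot>\<^bsub>M\<^esub> x) = c \<odot>\<^bsub>N\<^esub> h x" if "x \<in> carrier M" for c x
        by (rule h_eq[OF linear_relation_scale[OF R(1)]]) (use h that in auto)
    qed
    show "(y, h y) \<in> L" if "y \<in> carrier M" for y
      using h[OF that] R(3) by blast
    show "h y = z" if "(y, z) \<in> R0" for y z
      using h_eq R(2) that by blast
  qed
qed

section \<open>Averaging over a finite group\<close>

definition linear_action ::
  "'g monoid \<Rightarrow> (rat, 'a) module \<Rightarrow> ('g \<Rightarrow> 'a \<Rightarrow> 'a) \<Rightarrow> bool" where
  "linear_action G M \<rho> \<longleftrightarrow>
     (\<forall>a\<in>carrier G. linear_map M M (\<rho> a)) \<and>
     (\<forall>x\<in>carrier M. \<rho> \<one>\<^bsub>G\<^esub> x = x) \<and>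
     (\<forall>a\<in>carrier G. \<forall>b\<in>carrier G. \<forall>x\<in>carrier M. \<rho> (a \<otimes>\<^bsub>G\<^esub> b) x = \<rho> a (\<rho> b x))"

definition (in rat_space) average :: "'i set \<Rightarrow> ('i \<Rightarrow> 'a) \<Rightarrow> 'a" where
  "average A z = (1 / of_nat (card A)) \<odot> (\<Oplus>a\<in>A. z a)"

lemma linear_relation_finsum:
  assumes "rat_space M" "rat_space N" and L: "linear_relation M N L"
    and "finite A" "\<And>a. a \<in> A \<Longrightarrow> (y a, z a) \<in> L"
  shows "(\<Oplus>\<^bsub>M\<^esub>a\<in>A. y a, \<Oplus>\<^bsub>N\<^esub>a\<in>A. z a) \<in> L"
proof -
  interpret M: rat_space M by fact
  interpret N: rat_space N by fact
  show ?thesis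
    using assms(4,5)
  proof induction
    case empty
    then show ?case
      using linear_relation_zero[OF L] by simp
  next
    case (insert a A)
    have "y \<in> insert a A \<rightarrow> carrier M" "z \<in> insert a A \<rightarrow> carrier N"
      using linear_relation_carrier[OF L] insert.prems by blast+
    then show ?case
      using insert linear_relation_add[OF L] by (simp add: M.finsum_insert N.finsum_insert Pi_def)
  qed
qed

text \<open>
  A value that may be chosen in several ways may be replaced by the average of the choices, because
  the mean of the pairs \<open>(y, z a)\<close> is a pair with the same first component.
\<close>

lemma linear_relation_average:
  assumes "rat_space M" "rat_space N" and L: "linear_relation M N L"
    and A: "finite A" "A \<noteq> {}" and yz: "\<And>a. a \<in> A \<Longrightarrow> (y, z a) \<in> L"
  shows "(y, rat_space.average N A z) \<in> L"
proof -
  interpret M: rat_space M by fact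
  interpret N: rat_space N by fact
  have y: "y \<in> carrier M"
    using A(2) yz linear_relation_carrier[OF L] by blast
  have "(\<Oplus>\<^bsub>M\<^esub>a\<in>A. y, \<Oplus>\<^bsub>N\<^esub>a\<in>A. z a) \<in> L"
    using linear_relation_finsum[OF assms(1,2) L A(1), of "\<lambda>_. y"] yz by simp
  then have "((1 / of_nat (card A)) \<odot>\<^bsub>M\<^esub> (of_nat (card A) \<odot>\<^bsub>M\<^esub> y), N.average A z) \<in> L"
    unfolding N.average_def
    using linear_relation_scale[OF L] M.finsum_const_scale[OF A(1) y] by metis
  then show ?thesis
    using A y by (simp add: M.scale_scale)
qed

lemma (in rat_space) average_add:
  assumes "finite A" "z \<in> A \<rightarrow> carrier M" "z' \<in> A \<rightarrow> carrier M"
  shows "average A (\<lambda>a. z a \<oplus> z' a) = average A z \<oplus> average A z'"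
  using assms by (simp add: average_def finsum_addf scale_right_distrib)

lemma graph_linear_relation:
  assumes "rat_space M" "rat_space N" "linear_map M N f"
  shows "linear_relation M N {(x, f x) | x. x \<in> carrier M}"
proof -
  interpret M: rat_space M by fact
  interpret N: rat_space N by fact
  show ?thesis
    using linear_map_closed[OF assms(3)] linear_map_zero[OF assms]
    by (auto simp: linear_relation_def linear_map_add[OF assms(3)] linear_map_scale[OF assms(3)]
        intro!: exI[of _ "\<zero>\<^bsub>M\<^esub>"])
qed

text \<open>
  The graph of a linear map is a linear relation, so that closure of linear relations under sums
  gives that linear maps commute with sums.
\<close>

lemma linear_map_average:
  assumes M: "rat_space M" and N: "rat_space N" and f: "linear_map M N f"
    and A: "finite A" and z: "\<And>a. a \<in> A \<Longrightarrow> z a \<in> carrier M"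
  shows "f (rat_space.average M A z) = rat_space.average N A (\<lambda>a. f (z a))"
proof -
  interpret M: rat_space M by fact
  interpret N: rat_space N by fact
  have "(\<Oplus>\<^bsub>M\<^esub>a\<in>A. z a, \<Oplus>\<^bsub>N\<^esub>a\<in>A. f (z a)) \<in> {(x, f x) | x. x \<in> carrier M}"
    by (rule linear_relation_finsum[OF M N graph_linear_relation[OF M N f] A]) (use z in auto)
  then show ?thesis
    by (simp add: M.average_def N.average_def linear_map_scale[OF f])
qed

text \<open>
  Maschke's argument.  If the allowed values and the prescribed values are preserved by a finite
  group, each conjugate \<open>y \<mapsto> \<sigma> (inv a) (k (\<rho> a y))\<close> of a linear selection \<open>k\<close> is again a linear selection.
  Their average is one as well, and it is equivariant since translation by \<open>b\<close> only permutes the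
  conjugates.  Division by the order of the group uses that the scalars are rational.
\<close>

lemma equivariant_selection:
  assumes G: "group G" "finite (carrier G)"
    and M: "rat_space M" and N: "rat_space N"
    and \<rho>: "linear_action G M \<rho>" and \<sigma>: "linear_action G N \<sigma>"
    and L: "linear_relation M N L" and total: "carrier M \<subseteq> Domain L"
    and L_inv: "\<And>a y z. \<lbrakk>a \<in> carrier G; (y, z) \<in> L\<rbrakk> \<Longrightarrow> (\<rho> a y, \<sigma> a z) \<in> L"
    and R: "linear_relation M N R" "R \<subseteq> L"
    and R_inv: "\<And>a y z. \<lbrakk>a \<in> carrier G; (y, z) \<in> R\<rbrakk> \<Longrightarrow> (\<rho> a y, \<sigma> a z) \<in> R"
    and sv: "\<And>z. (\<zero>\<^bsub>M\<^esub>, z) \<in> R \<Longrightarrow> z = \<zero>\<^bsub>N\<^esub>"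
  obtains h where "linear_map M N h" "\<And>y. y \<in> carrier M \<Longrightarrow> (y, h y) \<in> L"
    "\<And>y z. (y, z) \<in> R \<Longrightarrow> h y = z"
    "\<And>a y. \<lbrakk>a \<in> carrier G; y \<in> carrier M\<rbrakk> \<Longrightarrow> h (\<rho> a y) = \<sigma> a (h y)"
proof -
  interpret G: group G by fact
  interpret M: rat_space M by fact
  interpret N: rat_space N by fact
  have \<rho>_lin: "linear_map M M (\<rho> a)" if "a \<in> carrier G" for a
    using \<rho> that by (simp add: linear_action_def)
  have \<sigma>_lin: "linear_map N N (\<sigma> a)" if "a \<in> carrier G" for a
    using \<sigma> that by (simp add: linear_action_def)
  have \<rho>_one: "\<rho> \<one>\<^bsub>G\<^esub> y = y" if "y \<in> carrier M" for y
    using \<rho> that by (simp add: linear_action_def)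
  have \<rho>_mult: "\<rho> (a \<otimes>\<^bsub>G\<^esub> b) y = \<rho> a (\<rho> b y)"
    if "a \<in> carrier G" "b \<in> carrier G" "y \<in> carrier M" for a b y
    using \<rho> that by (simp add: linear_action_def)
  have \<sigma>_mult: "\<sigma> (a \<otimes>\<^bsub>G\<^esub> b) z = \<sigma> a (\<sigma> b z)"
    if "a \<in> carrier G" "b \<in> carrier G" "z \<in> carrier N" for a b z
    using \<sigma> that by (simp add: linear_action_def)
  note \<rho>_closed = linear_map_closed[OF \<rho>_lin] and \<sigma>_closed = linear_map_closed[OF \<sigma>_lin]
  obtain k where k: "linear_map M N k" "\<And>y. y \<in> carrier M \<Longrightarrow> (y, k y) \<in> L"
    "\<And>y z. (y, z) \<in> R \<Longrightarrow> k y = z"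
    using linear_selection[OF M N L total R sv] by blast
  note k_closed = linear_map_closed[OF k(1)]
  define t where "t y a = \<sigma> (inv\<^bsub>G\<^esub> a) (k (\<rho> a y))" for y a
  define h where "h y = N.average (carrier G) (t y)" for y
  have t_closed: "t y a \<in> carrier N" if "y \<in> carrier M" "a \<in> carrier G" for y a
    using that by (simp add: t_def \<rho>_closed \<sigma>_closed k_closed)
  have ne: "carrier G \<noteq> {}"
    by blast
  have t_L: "(y, t y a) \<in> L" if "y \<in> carrier M" "a \<in> carrier G" for y a
  proof -
    have "(\<rho> (inv\<^bsub>G\<^esub> a) (\<rho> a y), t y a) \<in> L"
      unfolding t_def using that by (intro L_inv k \<rho>_closed) auto
    then show ?thesis
      using that by (simp add: \<rho>_mult[symmetric] \<rho>_one)
  qed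
  have t_R: "(y, t y a) \<in> R" if "(y, z) \<in> R" "a \<in> carrier G" for y z a
  proof -
    have y: "y \<in> carrier M"
      using linear_relation_carrier[OF R(1)] that by blast
    have "(\<rho> a y, k (\<rho> a y)) \<in> R"
      using R_inv[OF that(2,1)] k(3) by metis
    then have "(\<rho> (inv\<^bsub>G\<^esub> a) (\<rho> a y), t y a) \<in> R"
      unfolding t_def using that by (intro R_inv) auto
    then show ?thesis
      using that y by (simp add: \<rho>_mult[symmetric] \<rho>_one)
  qed
  show thesis
  proof (rule that)
    show "linear_map M N h"
      unfolding linear_map_def
    proof (intro conjI ballI allI)
      show "h \<in> carrier M \<rightarrow> carrier N"
        using t_closed by (auto simp: h_def N.average_def)
    next
      fix x y assume xy: "x \<in> carrier M" "y \<in> carrier M"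
      have "t (x \<oplus>\<^bsub>M\<^esub> y) a = t x a \<oplus>\<^bsub>N\<^esub> t y a" if "a \<in> carrier G" for a
        using xy that by (simp add: t_def \<rho>_closed k_closed linear_map_add[OF \<rho>_lin]
            linear_map_add[OF \<sigma>_lin] linear_map_add[OF k(1)])
      then have "h (x \<oplus>\<^bsub>M\<^esub> y) = N.average (carrier G) (\<lambda>a. t x a \<oplus>\<^bsub>N\<^esub> t y a)"
        unfolding h_def N.average_def
        by (intro arg_cong[where f = "\<lambda>z. _ \<odot>\<^bsub>N\<^esub> z"] N.finsum_cong' refl)
          (use xy t_closed in auto)
      also have "\<dots> = h x \<oplus>\<^bsub>N\<^esub> h y"
        unfolding h_def using G xy t_closed by (intro N.average_add) auto
      finally show "h (x \<oplus>\<^bsub>M\<^esub> y) = h x \<oplus>\<^bsub>N\<^esub> h y" .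
    next
      fix c x assume x: "x \<in> carrier M"
      have "linear_map N N (\<lambda>z. c \<odot>\<^bsub>N\<^esub> z)"
        by (auto simp: linear_map_def N.scale_right_distrib N.scale_scale mult.commute)
      then have "c \<odot>\<^bsub>N\<^esub> h x = N.average (carrier G) (\<lambda>a. c \<odot>\<^bsub>N\<^esub> t x a)"
        unfolding h_def using linear_map_average[OF N N] G t_closed x by metis
      also have "\<dots> = N.average (carrier G) (t (c \<odot>\<^bsub>M\<^esub> x))"
        unfolding N.average_def
      proof (intro arg_cong[where f = "\<lambda>z. _ \<odot>\<^bsub>N\<^esub> z"] N.finsum_cong' refl)
        fix a assume "a \<in> carrier G"
        then show "c \<odot>\<^bsub>N\<^esub> t x a = t (c \<odot>\<^bsub>M\<^esub> x) a"
          using x by (simp add: t_def \<rho>_closed k_closed linear_map_scale[OF \<rho>_lin]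
              linear_map_scale[OF \<sigma>_lin] linear_map_scale[OF k(1)])
      qed (use t_closed x in auto)
      finally show "h (c \<odot>\<^bsub>M\<^esub> x) = c \<odot>\<^bsub>N\<^esub> h x"
        unfolding h_def by (rule sym)
    qed
    show "(y, h y) \<in> L" if "y \<in> carrier M" for y
      unfolding h_def by (rule linear_relation_average[OF M N L G(2) ne t_L[OF that]])
    show "h y = z" if "(y, z) \<in> R" for y z
    proof (rule linear_relation_unique[OF M N R(1) sv])
      show "(y, h y) \<in> R"
        unfolding h_def by (rule linear_relation_average[OF M N R(1) G(2) ne t_R[OF that]])
    qed (use that in auto)
    show "h (\<rho> b y) = \<sigma> b (h y)" if b: "b \<in> carrier G" and y: "y \<in> carrier M" for b y
    proof -
      have shift: "(\<lambda>a. a \<otimes>\<^bsub>G\<^esub> b) ` carrier G = carrier G"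
      proof
        show "carrier G \<subseteq> (\<lambda>a. a \<otimes>\<^bsub>G\<^esub> b) ` carrier G"
        proof
          fix c assume "c \<in> carrier G"
          then have "c = c \<otimes>\<^bsub>G\<^esub> inv\<^bsub>G\<^esub> b \<otimes>\<^bsub>G\<^esub> b"
            using b by (simp add: G.m_assoc)
          then show "c \<in> (\<lambda>a. a \<otimes>\<^bsub>G\<^esub> b) ` carrier G"
            using b \<open>c \<in> carrier G\<close> by blast
        qed
      qed (use b in auto)
      have inj: "inj_on (\<lambda>a. a \<otimes>\<^bsub>G\<^esub> b) (carrier G)"
        using b by (rule G.inj_on_multc)
      have t_shift: "\<sigma> b (t y (a \<otimes>\<^bsub>G\<^esub> b)) = t (\<rho> b y) a" if "a \<in> carrier G" for a
      proof -
        have "\<sigma> b (t y (a \<otimes>\<^bsub>G\<^esub> b)) = \<sigma> (b \<otimes>\<^bsub>G\<^esub> inv\<^bsub>G\<^esub> (a \<otimes>\<^bsub>G\<^esub> b)) (k (\<rho> (a \<otimes>\<^bsub>G\<^esub> b) y))"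
          using that b y by (simp add: t_def \<rho>_closed k_closed \<sigma>_mult)
        also have "b \<otimes>\<^bsub>G\<^esub> inv\<^bsub>G\<^esub> (a \<otimes>\<^bsub>G\<^esub> b) = inv\<^bsub>G\<^esub> a"
          using that b by (simp add: G.inv_mult_group G.m_assoc[symmetric])
        finally show ?thesis
          using that b y by (simp add: t_def \<rho>_mult)
      qed
      have "\<sigma> b (h y) = N.average (carrier G) (\<lambda>a. \<sigma> b (t y a))"
        unfolding h_def using linear_map_average[OF N N \<sigma>_lin[OF b] G(2)] t_closed y by simp
      also have "\<dots> = N.average (carrier G) (\<lambda>a. \<sigma> b (t y (a \<otimes>\<^bsub>G\<^esub> b)))"
        unfolding N.average_def
        using N.finsum_reindex[of "\<lambda>a. \<sigma> b (t y a)" "\<lambda>a. a \<otimes>\<^bsub>G\<^esub> b" "carrier G"]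
          shift inj t_closed \<sigma>_closed b y by simp
      also have "\<dots> = h (\<rho> b y)"
        unfolding h_def N.average_def
        by (intro arg_cong[where f = "\<lambda>z. _ \<odot>\<^bsub>N\<^esub> z"] N.finsum_cong' refl)
          (use t_shift t_closed \<rho>_closed b y in auto)
      finally show ?thesis by (rule sym)
    qed
  qed
qed

section \<open>The orbit category of a commutative group\<close>

text \<open>
  For commutative \<open>G\<close> these are the automorphisms of the orbit, and multiplication by \<open>a\<close> is itself a
  \<open>G\<close>-map.
\<close>

definition translation :: "'g monoid \<Rightarrow> 'g set set \<Rightarrow> 'g \<Rightarrow> 'g set \<Rightarrow> 'g set" where
  "translation G S a = (\<lambda>C \<in> S. a <#\<^bsub>G\<^esub> C)"

lemma orbits_lcosets [simp, intro]: "subgroup H G \<Longrightarrow> lcosets\<^bsub>G\<^esub> H \<in> orbits G"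
  by (auto simp: orbits_def)

locale orbit_comm_group = comm_group G for G :: "'g monoid" (structure)
begin

lemma mem_lcosets: "C \<in> lcosets H \<longleftrightarrow> (\<exists>x \<in> carrier G. C = x <# H)"
  by (auto simp: LCOSETS_def)

lemma lcosets_translate:
  assumes "subgroup H G" "a \<in> carrier G" "C \<in> lcosets H"
  shows "a <# C \<in> lcosets H"
  using assms by (auto simp: mem_lcosets lcos_m_assoc subgroup.subset)

lemma lcoset_translate:
  assumes "subgroup H G" "a \<in> carrier G" "x \<in> carrier G"
  shows "a <# (x <# H) = (a \<otimes> x) <# H"
  using assms by (simp add: lcos_m_assoc subgroup.subset)

lemma lcoset_self_mem: "subgroup H G \<Longrightarrow> H \<in> lcosets H"
  using lcos_mult_one[of H] subgroup.subset[of H G] by (force simp: mem_lcosets)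

lemma translation_G_map:
  assumes "subgroup H G" "a \<in> carrier G"
  shows "translation G (lcosets H) a \<in> G_maps G (lcosets H) (lcosets H)"
  unfolding G_maps_def
proof (intro CollectI conjI ballI PiE_I)
  show "translation G (lcosets H) a C \<in> lcosets H" if "C \<in> lcosets H" for C
    using that assms lcosets_translate by (simp add: translation_def)
  show "translation G (lcosets H) a C = undefined" if "C \<notin> lcosets H" for C
    using that by (simp add: translation_def)
next
  fix g C assume g: "g \<in> carrier G" and "C \<in> lcosets H"
  then obtain x where x: "x \<in> carrier G" "C = x <# H"
    by (auto simp: mem_lcosets)
  have "a \<otimes> (g \<otimes> x) = g \<otimes> (a \<otimes> x)"
    using assms g x by (intro m_lcomm) auto
  then show "translation G (lcosets H) a (g <# C) = g <# translation G (lcosets H) a C"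
    using assms g x lcosets_translate[OF assms(1) g \<open>C \<in> lcosets H\<close>] \<open>C \<in> lcosets H\<close>
    by (simp add: translation_def lcoset_translate)
qed

lemma translation_one:
  assumes "subgroup H G"
  shows "translation G (lcosets H) \<one> = (\<lambda>C \<in> lcosets H. C)"
  unfolding translation_def
  by (rule restrict_ext) (use assms in \<open>auto simp: mem_lcosets lcoset_translate\<close>)

lemma translation_mult:
  assumes "subgroup H G" "a \<in> carrier G" "b \<in> carrier G"
  shows "translation G (lcosets H) (a \<otimes> b) =
    compose (lcosets H) (translation G (lcosets H) a) (translation G (lcosets H) b)"
proof
  fix C
  show "translation G (lcosets H) (a \<otimes> b) C =
    compose (lcosets H) (translation G (lcosets H) a) (translation G (lcosets H) b) C"
  proof (cases "C \<in> lcosets H")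
    case True
    then have "(a \<otimes> b) <# C = a <# (b <# C)"
      using assms by (auto simp: mem_lcosets lcoset_translate m_assoc)
    then show ?thesis
      using True assms lcosets_translate by (simp add: translation_def compose_def)
  qed (simp add: translation_def compose_def)
qed

lemma lcoset_absorb:
  assumes "subgroup H G" "subgroup K G" "H \<subseteq> K" "x \<in> carrier G"
  shows "(x <# H) <#> K = x <# K"
proof -
  have "H <#> K = K"
  proof
    show "H <#> K \<subseteq> K"
      using mono_set_mult[OF assms(3) order_refl] subgroup_mult_id[OF assms(2)] by blast
    show "K \<subseteq> H <#> K"
    proof
      fix k assume "k \<in> K"
      then have "k = \<one> \<otimes> k" "\<one> \<in> H"
        using assms subgroup.mem_carrier subgroup.one_closed by fastforce+
      then show "k \<in> H <#> K"
        using \<open>k \<in> K\<close> unfolding set_mult_def by blast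
    qed
  qed
  then show ?thesis
    using assms by (simp add: setmult_lcos_assoc subgroup.subset)
qed

lemma orbit_proj_lcoset:
  assumes "subgroup H G" "subgroup K G" "H \<subseteq> K" "x \<in> carrier G"
  shows "orbit_proj G H K (x <# H) = x <# K"
  using assms lcoset_absorb by (auto simp: orbit_proj_def mem_lcosets)

lemma orbit_proj_G_map:
  assumes "subgroup H G" "subgroup K G" "H \<subseteq> K"
  shows "orbit_proj G H K \<in> G_maps G (lcosets H) (lcosets K)"
  unfolding G_maps_def
proof (intro CollectI conjI ballI PiE_I)
  show "orbit_proj G H K C \<in> lcosets K" if "C \<in> lcosets H" for C
    using that orbit_proj_lcoset[OF assms] by (auto simp: mem_lcosets)
  show "orbit_proj G H K C = undefined" if "C \<notin> lcosets H" for C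
    using that by (simp add: orbit_proj_def)
  show "orbit_proj G H K (g <# C) = g <# orbit_proj G H K C"
    if "g \<in> carrier G" "C \<in> lcosets H" for g C
    using that assms by (auto simp: mem_lcosets lcoset_translate orbit_proj_lcoset)
qed

lemma orbit_proj_self:
  assumes "subgroup H G"
  shows "orbit_proj G H H = (\<lambda>C \<in> lcosets H. C)"
  unfolding orbit_proj_def
  by (rule restrict_ext) (use lcoset_absorb[OF assms assms] in \<open>auto simp: mem_lcosets\<close>)

lemma orbit_proj_trans:
  assumes "subgroup H G" "subgroup K G" "subgroup J G" "H \<subseteq> K" "K \<subseteq> J"
  shows "orbit_proj G H J = compose (lcosets H) (orbit_proj G K J) (orbit_proj G H K)"
proof
  fix C
  show "orbit_proj G H J C = compose (lcosets H) (orbit_proj G K J) (orbit_proj G H K) C"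
  proof (cases "C \<in> lcosets H")
    case True
    then show ?thesis
      using assms by (auto simp: mem_lcosets compose_def orbit_proj_lcoset)
  qed (simp add: orbit_proj_def compose_def)
qed

lemma translation_orbit_proj:
  assumes "subgroup H G" "subgroup K G" "H \<subseteq> K" "a \<in> carrier G"
  shows "compose (lcosets H) (translation G (lcosets K) a) (orbit_proj G H K) =
    compose (lcosets H) (orbit_proj G H K) (translation G (lcosets H) a)"
proof
  fix C
  show "compose (lcosets H) (translation G (lcosets K) a) (orbit_proj G H K) C =
    compose (lcosets H) (orbit_proj G H K) (translation G (lcosets H) a) C"
  proof (cases "C \<in> lcosets H")
    case True
    then show ?thesis
      using assms
      by (auto simp: mem_lcosets compose_def orbit_proj_lcoset translation_def lcoset_translate)
  qed (simp add: compose_def)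
qed

text \<open>
  A \<open>G\<close>-map \<open>G/H \<rightarrow> G/K\<close> is determined by the image \<open>aK\<close> of the coset \<open>H\<close>.  An element \<open>x\<close> of \<open>H\<close> fixes
  the coset \<open>H\<close> and therefore fixes \<open>aK\<close>, so \<open>x \<in> K\<close> by commutativity.  Hence naturality needs to be
  checked only for translations and for projections.
\<close>

lemma G_map_cases:
  assumes H: "subgroup H G" and K: "subgroup K G"
    and \<phi>: "\<phi> \<in> G_maps G (lcosets H) (lcosets K)"
  obtains a where "H \<subseteq> K" "a \<in> carrier G"
    "\<phi> = compose (lcosets H) (translation G (lcosets K) a) (orbit_proj G H K)"
proof -
  have eqv: "\<phi> (g <# C) = g <# \<phi> C" if "g \<in> carrier G" "C \<in> lcosets H" for g C
    using \<phi> that by (simp add: G_maps_def)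
  have "\<phi> H \<in> lcosets K"
    using \<phi> lcoset_self_mem[OF H] by (auto simp: G_maps_def)
  then obtain a where a: "a \<in> carrier G" "\<phi> H = a <# K"
    by (auto simp: mem_lcosets)
  have val: "\<phi> (x <# H) = (x \<otimes> a) <# K" if "x \<in> carrier G" for x
    using that eqv[OF that lcoset_self_mem[OF H]] a lcoset_translate[OF K] by simp
  have "H \<subseteq> K"
  proof
    fix x assume "x \<in> H"
    then have x: "x \<in> carrier G" "x <# H = H"
      using H subgroup.mem_carrier coset_join3 by metis+
    then have "(a \<otimes> x) <# K = a <# K"
      using val[of x] a m_comm by simp
    moreover have "a \<otimes> x \<in> (a \<otimes> x) <# K"
      using lcos_self[OF _ K] a x by simp
    ultimately obtain k where "k \<in> K" "a \<otimes> x = a \<otimes> k"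
      by (auto simp: l_coset_def)
    then show "x \<in> K"
      using a x K subgroup.mem_carrier by fastforce
  qed
  moreover have "\<phi> = compose (lcosets H) (translation G (lcosets K) a) (orbit_proj G H K)"
  proof
    fix C
    show "\<phi> C = compose (lcosets H) (translation G (lcosets K) a) (orbit_proj G H K) C"
    proof (cases "C \<in> lcosets H")
      case True
      then obtain x where x: "x \<in> carrier G" "C = x <# H"
        by (auto simp: mem_lcosets)
      then have "x <# K \<in> lcosets K"
        by (auto simp: mem_lcosets)
      then show ?thesis
        using True x a val \<open>H \<subseteq> K\<close> H K
        by (simp add: compose_def translation_def orbit_proj_lcoset lcoset_translate m_comm)
    next
      case False
      then show ?thesis
        using \<phi> by (auto simp: compose_def G_maps_def)
    qed
  qed
  ultimately show thesis
    using that a by blast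
qed

lemma lcosets_inj:
  assumes "subgroup H G" "subgroup K G" "lcosets H = lcosets K"
  shows "H = K"
proof -
  have "H \<in> lcosets K"
    using lcoset_self_mem assms by metis
  then obtain x where x: "x \<in> carrier G" "H = x <# K"
    by (auto simp: mem_lcosets)
  then have "\<one> \<in> x <# K"
    using assms(1) subgroup.one_closed by metis
  then have "x <# K = \<one> <# K"
    using l_repr_independence[OF _ x(1) assms(2)] by blast
  then show ?thesis
    using x assms lcos_mult_one subgroup.subset by metis
qed

subsection \<open>Subgroups of a commutative group of order \<open>p q\<close>\<close>

text \<open>
  The quotient by \<open>H\<close> has order \<open>card (rcosets H)\<close>, so that power is trivial there.
\<close>

lemma pow_index_mem_subgroup:
  assumes "subgroup H G" "x \<in> carrier G"
  shows "x [^] card (rcosets H) \<in> H"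
proof -
  interpret H: normal H G
    using assms(1) by (simp add: normal_iff_subgroup)
  interpret Q: group "G Mod H"
    by (rule H.factorgroup_is_group)
  have pow: "(H #> x) [^]\<^bsub>G Mod H\<^esub> n = H #> (x [^] n)" for n :: nat
    by (induction n) (use assms in \<open>simp_all add: H.rcos_sum FactGroup_def H.subset\<close>)
  have "H #> x \<in> carrier (G Mod H)"
    using assms(2) by (auto simp: carrier_FactGroup)
  then have "H #> (x [^] Coset.order (G Mod H)) = H"
    using Q.pow_order_eq_1 by (simp flip: pow)
  moreover have "Coset.order (G Mod H) = card (rcosets H)"
    by (simp add: Coset.order_def FactGroup_def)
  ultimately show ?thesis
    using coset_join1 assms by (simp add: H.subset)
qed

lemma subgroup_pow_closed:
  assumes "subgroup H G" "x \<in> H"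
  shows "x [^] (k :: nat) \<in> H"
proof (induction k)
  case 0
  then show ?case
    using subgroup.one_closed[OF assms(1)] by simp
next
  case (Suc k)
  then show ?case
    using subgroup.m_closed[OF assms(1) _ assms(2)] by simp
qed

text \<open>
  A subgroup whose order is coprime to its index is determined by its order.  Elements of \<open>H\<close> are
  killed by the order \<open>m\<close> of \<open>H\<close>.  Conversely let \<open>x\<close> be killed by \<open>m\<close>; its power to the index \<open>n\<close> lies
  in \<open>H\<close>, and from \<open>m u = n v + 1\<close> it follows that \<open>x\<close> is the inverse of a power of that element.
\<close>

lemma subgroup_eq_torsion:
  assumes H: "subgroup H G" and order: "Coset.order G = card H * n" and coprime: "coprime (card H) n" and nz: "card H \<noteq> 0"
  shows "H = {x \<in> carrier G. x [^] card H = \<one>}"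
proof
  show "H \<subseteq> {x \<in> carrier G. x [^] card H = \<one>}"
  proof
    fix x assume x: "x \<in> H"
    interpret H: group "G\<lparr>carrier := H\<rparr>"
      by (rule subgroup_imp_group[OF H])
    have "x [^]\<^bsub>G\<lparr>carrier := H\<rparr>\<^esub> card H = \<one>"
      using H.pow_order_eq_1[of x] x by (simp add: Coset.order_def)
    then have "x [^] card H = \<one>"
      using nat_pow_consistent[of x "card H" H] by simp
    then show "x \<in> {x \<in> carrier G. x [^] card H = \<one>}"
      using subgroup.mem_carrier[OF H x] by simp
  qed
  show "{x \<in> carrier G. x [^] card H = \<one>} \<subseteq> H"
  proof
    fix x assume "x \<in> {x \<in> carrier G. x [^] card H = \<one>}"
    then have x: "x \<in> carrier G" "x [^] card H = \<one>"
      by auto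
    have "card H * card (rcosets H) = card H * n"
      using lagrange[OF H] order by (simp only: mult.commute)
    then have "x [^] n \<in> H"
      using pow_index_mem_subgroup[OF H x(1)] nz by simp
    obtain u v where uv: "card H * u = n * v + 1"
      using bezout_nat[OF nz, of n] coprime by auto
    have "x [^] (n * v) = (x [^] n) [^] v"
      using x(1) by (rule nat_pow_pow[symmetric])
    then have mem: "x [^] (n * v) \<in> H"
      using subgroup_pow_closed[OF H \<open>x [^] n \<in> H\<close>] by (simp only:)
    have "x [^] (n * v) \<otimes> x = x [^] (card H * u)"
      unfolding uv by simp
    also have "\<dots> = (x [^] card H) [^] u"
      using x(1) by (rule nat_pow_pow[symmetric])
    also have "\<dots> = \<one>"
      using x(2) by simp
    finally have "inv (x [^] (n * v)) = x"
      using x(1) by (simp add: inv_equality m_comm)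
    then show "x \<in> H"
      using subgroup.m_inv_closed[OF H mem] by simp
  qed
qed

lemma not_subset_of_coprime_card:
  assumes "subgroup H G" "subgroup K G" "coprime (card H) (card K)" "card H \<noteq> 1"
  shows "\<not> H \<subseteq> K"
proof
  assume "H \<subseteq> K"
  interpret K: group "G\<lparr>carrier := K\<rparr>"
    by (rule subgroup_imp_group[OF assms(2)])
  have "card (rcosets\<^bsub>G\<lparr>carrier := K\<rparr>\<^esub> H) * card H = card K"
    using K.lagrange[OF subgroup_incl[OF assms(1,2) \<open>H \<subseteq> K\<close>]] by (simp add: Coset.order_def)
  then have "card H dvd card K"
    by (metis dvd_triv_right)
  then show False
    using coprime_common_divisor[OF assms(3) dvd_refl] assms(4) by simp
qed

text \<open>
  The order of \<open>H\<close> divides \<open>p q\<close>; if it is \<open>p\<close> or \<open>q\<close>, it is coprime to the index, so \<open>H\<close> and the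
  given subgroup of that order are the same set of torsion elements.
\<close>

lemma subgroups_of_order_pq:
  assumes p: "Factorial_Ring.prime p" and q: "Factorial_Ring.prime q" and "p \<noteq> q"
    and order: "Coset.order G = p * q"
    and P: "subgroup P G" "card P = p" and Q: "subgroup Q G" "card Q = q"
    and H: "subgroup H G"
  shows "H \<in> {{\<one>}, P, Q, carrier G}"
proof -
  have fin: "finite (carrier G)"
    using order p q order_gt_0_iff_finite by (simp add: prime_gt_0_nat)
  have cop: "coprime p q" "coprime q p"
    using p q \<open>p \<noteq> q\<close> primes_coprime by auto
  have nz: "p \<noteq> 0" "q \<noteq> 0"
    using p q by auto
  have "card H dvd p * q"
    using lagrange[OF H] order by (metis dvd_triv_right)
  then obtain a b where ab: "card H = a * b" "a dvd p" "b dvd q"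
    by (rule division_decomp[THEN exE]) auto
  then have "a = 1 \<or> a = p" "b = 1 \<or> b = q"
    using p q by (auto simp: prime_nat_iff)
  then consider "card H = 1" | "card H = p" | "card H = q" | "card H = p * q"
    using ab by auto
  then show ?thesis
  proof cases
    case 1
    then show ?thesis
      using subgroup.one_closed[OF H] by (auto simp: card_1_singleton_iff)
  next
    case 2
    then show ?thesis
      using subgroup_eq_torsion[OF H, of q] subgroup_eq_torsion[OF P(1), of q] P order cop nz by simp
  next
    case 3
    then show ?thesis
      using subgroup_eq_torsion[OF H, of p] subgroup_eq_torsion[OF Q(1), of p] Q order cop nz
      by (simp add: mult.commute)
  next
    case 4
    then show ?thesis
      using card_subset_eq[OF fin subgroup.subset[OF H]] order by (simp add: Coset.order_def)
  qed
qed

end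

section \<open>Coefficient systems over a commutative group\<close>

text \<open>
  The two kinds of structure maps to which every structure map of a coefficient system reduces: those
  of the projections \<open>G/H \<rightarrow> G/K\<close>, and those of the automorphisms of one orbit, which form a linear
  action of \<open>G\<close>.
\<close>

definition proj_map :: "'g monoid \<Rightarrow> ('g, 'a) coef \<Rightarrow> 'g set \<Rightarrow> 'g set \<Rightarrow> nat \<Rightarrow> 'a \<Rightarrow> 'a" where
  "proj_map G V H K = cmor V (lcosets\<^bsub>G\<^esub> H) (lcosets\<^bsub>G\<^esub> K) (orbit_proj G H K)"

definition translation_map :: "'g monoid \<Rightarrow> ('g, 'a) coef \<Rightarrow> 'g set \<Rightarrow> nat \<Rightarrow> 'g \<Rightarrow> 'a \<Rightarrow> 'a" where
  "translation_map G V H n a =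
     cmor V (lcosets\<^bsub>G\<^esub> H) (lcosets\<^bsub>G\<^esub> H) (translation G (lcosets\<^bsub>G\<^esub> H) a) n"

abbreviation coef_at :: "'g monoid \<Rightarrow> ('g, 'a) coef \<Rightarrow> 'g set \<Rightarrow> nat \<Rightarrow> (rat, 'a) module" where
  "coef_at G V H n \<equiv> cob V (lcosets\<^bsub>G\<^esub> H) n"

locale comm_coef_system = orbit_comm_group G + coef_system G V
  for G :: "'g monoid" (structure) and V :: "('g, 'a) coef"
begin

lemma rat_space_at: "subgroup H G \<Longrightarrow> rat_space (coef_at G V H n)"
  using graded_vsD ob orbits_lcosets by blast

lemma translation_map_action:
  assumes "subgroup H G"
  shows "linear_action G (coef_at G V H n) (translation_map G V H n)"
  unfolding linear_action_def translation_map_def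
proof (intro conjI ballI)
  fix a assume "a \<in> carrier G"
  then show "linear_map (coef_at G V H n) (coef_at G V H n)
      (cmor V (lcosets H) (lcosets H) (translation G (lcosets H) a) n)"
    using assms by (intro mor translation_G_map) auto
next
  fix x assume "x \<in> carrier (coef_at G V H n)"
  then show "cmor V (lcosets H) (lcosets H) (translation G (lcosets H) \<one>) n x = x"
    using assms by (simp add: translation_one mor_id)
next
  fix a b x assume "a \<in> carrier G" "b \<in> carrier G" "x \<in> carrier (coef_at G V H n)"
  then show "cmor V (lcosets H) (lcosets H) (translation G (lcosets H) (a \<otimes> b)) n x =
      cmor V (lcosets H) (lcosets H) (translation G (lcosets H) a) n
        (cmor V (lcosets H) (lcosets H) (translation G (lcosets H) b) n x)"
    using assms by (simp add: translation_mult mor_comp translation_G_map)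
qed

lemma translation_map_linear:
  assumes "subgroup H G" "a \<in> carrier G"
  shows "linear_map (coef_at G V H n) (coef_at G V H n) (translation_map G V H n a)"
  using translation_map_action[OF assms(1)] assms(2) by (simp add: linear_action_def)

lemma proj_map_linear:
  assumes "subgroup H G" "subgroup K G" "H \<subseteq> K"
  shows "linear_map (coef_at G V H n) (coef_at G V K n) (proj_map G V H K n)"
  unfolding proj_map_def using assms by (intro mor orbit_proj_G_map) auto

lemma proj_map_self:
  assumes "subgroup H G" "x \<in> carrier (coef_at G V H n)"
  shows "proj_map G V H H n x = x"
  using assms by (simp add: proj_map_def orbit_proj_self mor_id)

lemma proj_map_trans:
  assumes "subgroup H G" "subgroup K G" "subgroup J G" "H \<subseteq> K" "K \<subseteq> J"
    and "x \<in> carrier (coef_at G V H n)"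
  shows "proj_map G V H J n x = proj_map G V K J n (proj_map G V H K n x)"
  unfolding proj_map_def orbit_proj_trans[OF assms(1-5)]
  using assms by (intro mor_comp orbit_proj_G_map) auto

lemma translation_map_proj_map:
  assumes "subgroup H G" "subgroup K G" "H \<subseteq> K" "a \<in> carrier G"
    and "x \<in> carrier (coef_at G V H n)"
  shows "translation_map G V K n a (proj_map G V H K n x) =
    proj_map G V H K n (translation_map G V H n a x)"
proof -
  have "translation_map G V K n a (proj_map G V H K n x) =
      cmor V (lcosets H) (lcosets K)
        (compose (lcosets H) (translation G (lcosets K) a) (orbit_proj G H K)) n x"
    unfolding translation_map_def proj_map_def
    using assms by (intro mor_comp[symmetric] orbit_proj_G_map translation_G_map) auto
  also have "\<dots> = proj_map G V H K n (translation_map G V H n a x)"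
    unfolding translation_map_def proj_map_def translation_orbit_proj[OF assms(1-4)]
    using assms by (intro mor_comp orbit_proj_G_map translation_G_map) auto
  finally show ?thesis .
qed

lemma cmor_compose_translation_proj:
  assumes "subgroup H G" "subgroup K G" "H \<subseteq> K" "a \<in> carrier G"
    and "x \<in> carrier (coef_at G V H n)"
  shows "cmor V (lcosets H) (lcosets K)
      (compose (lcosets H) (translation G (lcosets K) a) (orbit_proj G H K)) n x =
    translation_map G V K n a (proj_map G V H K n x)"
  unfolding translation_map_def proj_map_def
  using assms by (intro mor_comp orbit_proj_G_map translation_G_map) auto

end

section \<open>Extending a morphism orbit by orbit\<close>

text \<open>
  The task of extending \<open>g : V \<rightarrow> I\<close> along the injection \<open>f : V \<rightarrow> W\<close>.
\<close>

locale extension_problem =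
  orbit_comm_group G + V: comm_coef_system G V + W: comm_coef_system G W + I: comm_coef_system G I
  for G :: "'g monoid" (structure)
    and V :: "('g, 'x) coef" and W :: "('g, 'y) coef" and I :: "('g, 'a) coef" +
  fixes f :: "'g set set \<Rightarrow> nat \<Rightarrow> 'x \<Rightarrow> 'y" and g :: "'g set set \<Rightarrow> nat \<Rightarrow> 'x \<Rightarrow> 'a"
  assumes finite_G: "finite (carrier G)"
    and f: "coef_inj_morphism G V W f" and g: "coef_morphism G V I g"
begin

text \<open>
  An extension is built orbit by orbit.  The first notion collects what concerns a single orbit
  \<open>G/H\<close>, the second is naturality for the projection \<open>G/H \<rightarrow> G/K\<close>.
\<close>

definition extension_at :: "'g set \<Rightarrow> (nat \<Rightarrow> 'y \<Rightarrow> 'a) \<Rightarrow> bool" where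
  "extension_at H h \<longleftrightarrow> (\<forall>n.
     linear_map (coef_at G W H n) (coef_at G I H n) (h n) \<and>
     (\<forall>x \<in> carrier (coef_at G V H n). h n (f (lcosets H) n x) = g (lcosets H) n x) \<and>
     (\<forall>a \<in> carrier G. \<forall>y \<in> carrier (coef_at G W H n).
        h n (translation_map G W H n a y) = translation_map G I H n a (h n y)))"

definition compatible :: "'g set \<Rightarrow> 'g set \<Rightarrow> (nat \<Rightarrow> 'y \<Rightarrow> 'a) \<Rightarrow> (nat \<Rightarrow> 'y \<Rightarrow> 'a) \<Rightarrow> bool" where
  "compatible H K h k \<longleftrightarrow> (\<forall>n. \<forall>y \<in> carrier (coef_at G W H n).
     k n (proj_map G W H K n y) = proj_map G I H K n (h n y))"

lemma extension_at_closed: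
  assumes "extension_at H h" "y \<in> carrier (coef_at G W H n)"
  shows "h n y \<in> carrier (coef_at G I H n)"
proof -
  have "linear_map (coef_at G W H n) (coef_at G I H n) (h n)"
    using assms(1) by (simp add: extension_at_def)
  then show ?thesis
    using assms(2) by (rule linear_map_closed)
qed

lemma f_linear: "subgroup H G \<Longrightarrow> linear_map (coef_at G V H n) (coef_at G W H n) (f (lcosets H) n)"
  using f by (simp add: coef_inj_morphism_def coef_morphism_def)

lemma g_linear: "subgroup H G \<Longrightarrow> linear_map (coef_at G V H n) (coef_at G I H n) (g (lcosets H) n)"
  using g by (simp add: coef_morphism_def)

lemma f_natural:
  "\<lbrakk>subgroup H G; subgroup K G; \<phi> \<in> G_maps G (lcosets H) (lcosets K); x \<in> carrier (coef_at G V H n)\<rbrakk>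
    \<Longrightarrow> f (lcosets K) n (cmor V (lcosets H) (lcosets K) \<phi> n x) =
      cmor W (lcosets H) (lcosets K) \<phi> n (f (lcosets H) n x)"
  using f by (simp add: coef_inj_morphism_def coef_morphism_def)

lemma g_natural:
  "\<lbrakk>subgroup H G; subgroup K G; \<phi> \<in> G_maps G (lcosets H) (lcosets K); x \<in> carrier (coef_at G V H n)\<rbrakk>
    \<Longrightarrow> g (lcosets K) n (cmor V (lcosets H) (lcosets K) \<phi> n x) =
      cmor I (lcosets H) (lcosets K) \<phi> n (g (lcosets H) n x)"
  using g by (simp add: coef_morphism_def)

text \<open>
  The values forced by \<open>h \<circ> f = g\<close>.
\<close>

lemma prescribed_linear_relation:
  assumes H: "subgroup H G"
  shows "linear_relation (coef_at G W H n) (coef_at G I H n)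
    {(f (lcosets H) n x, g (lcosets H) n x) | x. x \<in> carrier (coef_at G V H n)}"
    (is "linear_relation ?W ?I ?R")
proof -
  interpret VH: rat_space "coef_at G V H n" by (rule V.rat_space_at[OF H])
  have RI: "(y, z) \<in> ?R"
    if "x \<in> carrier (coef_at G V H n)" "y = f (lcosets H) n x" "z = g (lcosets H) n x" for x y z
    using that by blast
  note lin = f_linear[OF H, of n] g_linear[OF H, of n]
  show ?thesis
    unfolding linear_relation_def
  proof (intro conjI allI impI)
    show "?R \<subseteq> carrier ?W \<times> carrier ?I"
      using lin[THEN linear_map_closed] by auto
    show "(\<zero>\<^bsub>?W\<^esub>, \<zero>\<^bsub>?I\<^esub>) \<in> ?R"
      by (rule RI[OF VH.zero_closed])
        (simp_all add: linear_map_zero[OF V.rat_space_at W.rat_space_at f_linear] H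
          linear_map_zero[OF V.rat_space_at I.rat_space_at g_linear])
  next
    fix y z y' z' assume "(y, z) \<in> ?R" "(y', z') \<in> ?R"
    then obtain x x' where "x \<in> carrier (coef_at G V H n)" "x' \<in> carrier (coef_at G V H n)"
      "y = f (lcosets H) n x" "z = g (lcosets H) n x"
      "y' = f (lcosets H) n x'" "z' = g (lcosets H) n x'"
      by blast
    then show "(y \<oplus>\<^bsub>?W\<^esub> y', z \<oplus>\<^bsub>?I\<^esub> z') \<in> ?R"
      by (intro RI[of "x \<oplus>\<^bsub>coef_at G V H n\<^esub> x'"]) (simp_all add: lin[THEN linear_map_add])
  next
    fix c y z assume "(y, z) \<in> ?R"
    then obtain x where "x \<in> carrier (coef_at G V H n)"
      "y = f (lcosets H) n x" "z = g (lcosets H) n x"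
      by blast
    then show "(c \<odot>\<^bsub>?W\<^esub> y, c \<odot>\<^bsub>?I\<^esub> z) \<in> ?R"
      by (intro RI[of "c \<odot>\<^bsub>coef_at G V H n\<^esub> x"]) (simp_all add: lin[THEN linear_map_scale])
  qed
qed

text \<open>
  The values allowed by naturality for the projections to orbits on which the extension is already
  known.
\<close>

lemma compatible_linear_relation:
  assumes H: "subgroup H G"
    and K: "\<And>K. K \<in> \<K> \<Longrightarrow> subgroup K G \<and> H \<subseteq> K \<and> extension_at K (k K)"
  shows "linear_relation (coef_at G W H n) (coef_at G I H n)
    {(y, z). y \<in> carrier (coef_at G W H n) \<and> z \<in> carrier (coef_at G I H n) \<and>
      (\<forall>K \<in> \<K>. k K n (proj_map G W H K n y) = proj_map G I H K n z)}"
    (is "linear_relation ?W ?I ?L")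
proof -
  interpret WH: rat_space ?W by (rule W.rat_space_at[OF H])
  interpret IH: rat_space ?I by (rule I.rat_space_at[OF H])
  have pW: "linear_map ?W (coef_at G W K n) (proj_map G W H K n)"
    and pI: "linear_map ?I (coef_at G I K n) (proj_map G I H K n)"
    and kK: "linear_map (coef_at G W K n) (coef_at G I K n) (k K n)"
    and sp: "rat_space (coef_at G W K n)" "rat_space (coef_at G I K n)" if "K \<in> \<K>" for K
    using K[OF that] H W.proj_map_linear I.proj_map_linear W.rat_space_at I.rat_space_at
    by (auto simp: extension_at_def)
  show ?thesis
    unfolding linear_relation_def
  proof (intro conjI allI impI)
    show "?L \<subseteq> carrier ?W \<times> carrier ?I"
      by auto
    have "k K n (proj_map G W H K n \<zero>\<^bsub>?W\<^esub>) = proj_map G I H K n \<zero>\<^bsub>?I\<^esub>" if "K \<in> \<K>" for K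
      using linear_map_zero[OF WH.rat_space_axioms sp(1)[OF that] pW[OF that]]
        linear_map_zero[OF IH.rat_space_axioms sp(2)[OF that] pI[OF that]]
        linear_map_zero[OF sp[OF that] kK[OF that]] by simp
    then show "(\<zero>\<^bsub>?W\<^esub>, \<zero>\<^bsub>?I\<^esub>) \<in> ?L"
      by simp
  next
    fix y z y' z' assume "(y, z) \<in> ?L" "(y', z') \<in> ?L"
    then show "(y \<oplus>\<^bsub>?W\<^esub> y', z \<oplus>\<^bsub>?I\<^esub> z') \<in> ?L"
      by (auto simp: linear_map_add[OF pW] linear_map_add[OF pI] linear_map_add[OF kK]
          linear_map_closed[OF pW])
  next
    fix c y z assume "(y, z) \<in> ?L"
    then show "(c \<odot>\<^bsub>?W\<^esub> y, c \<odot>\<^bsub>?I\<^esub> z) \<in> ?L"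
      by (auto simp: linear_map_scale[OF pW] linear_map_scale[OF pI] linear_map_scale[OF kK]
          linear_map_closed[OF pW])
  qed
qed

text \<open>
  Given extensions \<open>k K\<close> on some orbits \<open>G/K\<close> below \<open>G/H\<close>, an extension on \<open>G/H\<close> compatible with all of
  them exists as soon as each single vector \<open>y\<close> has an image that is compatible: linearity,
  equivariance and the prescribed values on the image of \<open>f\<close> then come for free from
  equivariant selection.
\<close>

lemma extension_step:
  assumes H: "subgroup H G"
    and K: "\<And>K. K \<in> \<K> \<Longrightarrow> subgroup K G \<and> H \<subseteq> K \<and> extension_at K (k K)"
    and lift: "\<And>n y. y \<in> carrier (coef_at G W H n) \<Longrightarrow>
      \<exists>z \<in> carrier (coef_at G I H n). \<forall>K \<in> \<K>. k K n (proj_map G W H K n y) = proj_map G I H K n z"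
  obtains h where "extension_at H h" "\<And>K. K \<in> \<K> \<Longrightarrow> compatible H K h (k K)"
proof -
  define L where "L n = {(y, z). y \<in> carrier (coef_at G W H n) \<and> z \<in> carrier (coef_at G I H n) \<and>
      (\<forall>K \<in> \<K>. k K n (proj_map G W H K n y) = proj_map G I H K n z)}" for n
  define R where
    "R n = {(f (lcosets H) n x, g (lcosets H) n x) | x. x \<in> carrier (coef_at G V H n)}" for n
  have "\<exists>h. linear_map (coef_at G W H n) (coef_at G I H n) h \<and>
      (\<forall>y \<in> carrier (coef_at G W H n). (y, h y) \<in> L n) \<and>
      (\<forall>x \<in> carrier (coef_at G V H n). h (f (lcosets H) n x) = g (lcosets H) n x) \<and>
      (\<forall>a \<in> carrier G. \<forall>y \<in> carrier (coef_at G W H n).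
        h (translation_map G W H n a y) = translation_map G I H n a (h y))" for n
  proof -
    note actW = W.translation_map_action[OF H, of n] and actI = I.translation_map_action[OF H, of n]
    have linL: "linear_relation (coef_at G W H n) (coef_at G I H n) (L n)"
      unfolding L_def by (rule compatible_linear_relation[OF H K])
    have linR: "linear_relation (coef_at G W H n) (coef_at G I H n) (R n)"
      unfolding R_def by (rule prescribed_linear_relation[OF H])
    have total: "carrier (coef_at G W H n) \<subseteq> Domain (L n)"
      using lift by (fastforce simp: L_def)
    have L_inv: "(translation_map G W H n a y, translation_map G I H n a z) \<in> L n"
      if a: "a \<in> carrier G" and yz: "(y, z) \<in> L n" for a y z
    proof -
      have carr: "y \<in> carrier (coef_at G W H n)" "z \<in> carrier (coef_at G I H n)"
        and eq: "\<And>K. K \<in> \<K> \<Longrightarrow> k K n (proj_map G W H K n y) = proj_map G I H K n z"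
        using yz by (auto simp: L_def)
      have "k K n (proj_map G W H K n (translation_map G W H n a y)) =
          proj_map G I H K n (translation_map G I H n a z)" if "K \<in> \<K>" for K
      proof -
        have K': "subgroup K G" "H \<subseteq> K" "extension_at K (k K)"
          using K[OF that] by auto
        have "k K n (proj_map G W H K n (translation_map G W H n a y)) =
            k K n (translation_map G W K n a (proj_map G W H K n y))"
          using W.translation_map_proj_map[OF H K'(1,2) a carr(1)] by simp
        also have "\<dots> = translation_map G I K n a (k K n (proj_map G W H K n y))"
          using K'(3) a linear_map_closed[OF W.proj_map_linear[OF H K'(1,2)] carr(1)]
          by (simp add: extension_at_def)
        also have "\<dots> = proj_map G I H K n (translation_map G I H n a z)"
          using I.translation_map_proj_map[OF H K'(1,2) a carr(2)] eq[OF that] by simp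
        finally show ?thesis .
      qed
      then show ?thesis
        using carr linear_map_closed[OF W.translation_map_linear[OF H a]]
          linear_map_closed[OF I.translation_map_linear[OF H a]] by (simp add: L_def)
    qed
    have R_L: "R n \<subseteq> L n"
    proof
      fix w assume "w \<in> R n"
      then obtain x where x: "x \<in> carrier (coef_at G V H n)"
        and w: "w = (f (lcosets H) n x, g (lcosets H) n x)"
        by (auto simp: R_def)
      have "k K n (proj_map G W H K n (f (lcosets H) n x)) = proj_map G I H K n (g (lcosets H) n x)"
        if "K \<in> \<K>" for K
      proof -
        have K': "subgroup K G" "H \<subseteq> K" "extension_at K (k K)"
          using K[OF that] by auto
        have "k K n (proj_map G W H K n (f (lcosets H) n x)) =
            k K n (f (lcosets K) n (proj_map G V H K n x))"
          using f_natural[OF H K'(1) orbit_proj_G_map[OF H K'(1,2)] x] by (simp add: proj_map_def)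
        also have "\<dots> = g (lcosets K) n (proj_map G V H K n x)"
          using K'(3) linear_map_closed[OF V.proj_map_linear[OF H K'(1,2)] x]
          by (simp add: extension_at_def)
        also have "\<dots> = proj_map G I H K n (g (lcosets H) n x)"
          using g_natural[OF H K'(1) orbit_proj_G_map[OF H K'(1,2)] x] by (simp add: proj_map_def)
        finally show ?thesis .
      qed
      then show "w \<in> L n"
        using x linear_map_closed[OF f_linear[OF H]] linear_map_closed[OF g_linear[OF H]]
        by (simp add: L_def w)
    qed
    have R_inv: "(translation_map G W H n a y, translation_map G I H n a z) \<in> R n"
      if a: "a \<in> carrier G" and yz: "(y, z) \<in> R n" for a y z
    proof -
      obtain x where x: "x \<in> carrier (coef_at G V H n)"
        "y = f (lcosets H) n x" "z = g (lcosets H) n x"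
        using yz by (auto simp: R_def)
      let ?x = "translation_map G V H n a x"
      have "?x \<in> carrier (coef_at G V H n)"
        using linear_map_closed[OF V.translation_map_linear[OF H a] x(1)] .
      moreover have "translation_map G W H n a y = f (lcosets H) n ?x"
        using f_natural[OF H H translation_G_map[OF H a] x(1)] x by (simp add: translation_map_def)
      moreover have "translation_map G I H n a z = g (lcosets H) n ?x"
        using g_natural[OF H H translation_G_map[OF H a] x(1)] x by (simp add: translation_map_def)
      ultimately show ?thesis
        unfolding R_def by blast
    qed
    have single: "z = \<zero>\<^bsub>coef_at G I H n\<^esub>" if z: "(\<zero>\<^bsub>coef_at G W H n\<^esub>, z) \<in> R n" for z
    proof -
      interpret VH: rat_space "coef_at G V H n" by (rule V.rat_space_at[OF H])
      obtain x where x: "x \<in> carrier (coef_at G V H n)"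
        "\<zero>\<^bsub>coef_at G W H n\<^esub> = f (lcosets H) n x" "z = g (lcosets H) n x"
        using z by (auto simp: R_def)
      moreover have "inj_on (f (lcosets H) n) (carrier (coef_at G V H n))"
        using f H by (simp add: coef_inj_morphism_def)
      ultimately have "x = \<zero>\<^bsub>coef_at G V H n\<^esub>"
        using linear_map_zero[OF V.rat_space_at[OF H] W.rat_space_at[OF H] f_linear[OF H]]
        by (metis VH.zero_closed inj_onD)
      then show ?thesis
        using x linear_map_zero[OF V.rat_space_at[OF H] I.rat_space_at[OF H] g_linear[OF H]] by simp
    qed
    obtain h where h: "linear_map (coef_at G W H n) (coef_at G I H n) h"
      "\<And>y. y \<in> carrier (coef_at G W H n) \<Longrightarrow> (y, h y) \<in> L n"
      "\<And>y z. (y, z) \<in> R n \<Longrightarrow> h y = z"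
      "\<And>a y. \<lbrakk>a \<in> carrier G; y \<in> carrier (coef_at G W H n)\<rbrakk>
        \<Longrightarrow> h (translation_map G W H n a y) = translation_map G I H n a (h y)"
      using equivariant_selection[OF is_group finite_G W.rat_space_at[OF H] I.rat_space_at[OF H]
          actW actI linL total L_inv linR R_L R_inv single] by blast
    moreover have "(f (lcosets H) n x, g (lcosets H) n x) \<in> R n"
      if "x \<in> carrier (coef_at G V H n)" for x
      using that by (auto simp: R_def)
    ultimately show ?thesis
      by blast
  qed
  then obtain h where h: "\<And>n. linear_map (coef_at G W H n) (coef_at G I H n) (h n) \<and>
      (\<forall>y \<in> carrier (coef_at G W H n). (y, h n y) \<in> L n) \<and>
      (\<forall>x \<in> carrier (coef_at G V H n). h n (f (lcosets H) n x) = g (lcosets H) n x) \<and>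
      (\<forall>a \<in> carrier G. \<forall>y \<in> carrier (coef_at G W H n).
        h n (translation_map G W H n a y) = translation_map G I H n a (h n y))"
    by metis
  show thesis
  proof (rule that)
    show "extension_at H h"
      unfolding extension_at_def using h by simp
    show "compatible H K h (k K)" if "K \<in> \<K>" for K
      unfolding compatible_def using h that by (auto simp: L_def)
  qed
qed

text \<open>
  A morphism of coefficient systems is indexed by orbits, a compatible family by subgroups; since
  \<open>G/H\<close> determines \<open>H\<close>, one can be converted into the other.  Naturality for an arbitrary \<open>G\<close>-map
  follows from its factorization into a projection and a translation.
\<close>

lemma extension_morphism:
  assumes ext: "\<And>H. subgroup H G \<Longrightarrow> extension_at H (h H)"
    and compat: "\<And>H K. \<lbrakk>subgroup H G; subgroup K G; H \<subseteq> K\<rbrakk> \<Longrightarrow> compatible H K (h H) (h K)"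
  shows "\<exists>k. coef_morphism G W I k \<and>
    (\<forall>S \<in> orbits G. \<forall>n. \<forall>x \<in> carrier (cob V S n). k S n (f S n x) = g S n x)"
proof -
  define k where "k S = h (THE H. subgroup H G \<and> lcosets H = S)" for S
  have k: "k (lcosets H) = h H" if "subgroup H G" for H
  proof -
    have "(THE H'. subgroup H' G \<and> lcosets H' = lcosets H) = H"
      using that lcosets_inj by (intro the_equality) auto
    then show ?thesis
      by (simp add: k_def)
  qed
  have orbitsE: "\<exists>H. subgroup H G \<and> S = lcosets H" if "S \<in> orbits G" for S
    using that by (auto simp: orbits_def)
  have "coef_morphism G W I k"
    unfolding coef_morphism_def
  proof (intro conjI ballI allI)
    fix S n assume "S \<in> orbits G"
    then obtain H where H: "subgroup H G" "S = lcosets H"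
      using orbitsE by blast
    show "linear_map (cob W S n) (cob I S n) (k S n)"
      using ext[OF H(1)] k[OF H(1)] by (simp add: extension_at_def H(2))
  next
    fix S T \<phi> n y
    assume "S \<in> orbits G" "T \<in> orbits G" and \<phi>: "\<phi> \<in> G_maps G S T" and y: "y \<in> carrier (cob W S n)"
    then obtain H K where H: "subgroup H G" "S = lcosets H" and K: "subgroup K G" "T = lcosets K"
      using orbitsE by metis
    obtain a where HK: "H \<subseteq> K" and a: "a \<in> carrier G"
      and \<phi>_eq: "\<phi> = compose (lcosets H) (translation G (lcosets K) a) (orbit_proj G H K)"
      using G_map_cases[OF H(1) K(1)] \<phi> H(2) K(2) by blast
    have y': "y \<in> carrier (coef_at G W H n)"
      using y H(2) by simp
    have hy: "h H n y \<in> carrier (coef_at G I H n)"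
      using extension_at_closed[OF ext[OF H(1)] y'] .
    have "k T n (cmor W S T \<phi> n y) = h K n (translation_map G W K n a (proj_map G W H K n y))"
      using W.cmor_compose_translation_proj[OF H(1) K(1) HK a y'] k[OF K(1)] H(2) K(2) \<phi>_eq by simp
    also have "\<dots> = translation_map G I K n a (h K n (proj_map G W H K n y))"
      using ext[OF K(1)] a linear_map_closed[OF W.proj_map_linear[OF H(1) K(1) HK] y']
      by (simp add: extension_at_def)
    also have "\<dots> = translation_map G I K n a (proj_map G I H K n (h H n y))"
      using compat[OF H(1) K(1) HK] y' by (simp add: compatible_def)
    also have "\<dots> = cmor I S T \<phi> n (k S n y)"
      using I.cmor_compose_translation_proj[OF H(1) K(1) HK a hy] k[OF H(1)] H(2) K(2) \<phi>_eq by simp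
    finally show "k T n (cmor W S T \<phi> n y) = cmor I S T \<phi> n (k S n y)" .
  qed
  moreover have "k S n (f S n x) = g S n x" if "S \<in> orbits G" "x \<in> carrier (cob V S n)" for S n x
    using orbitsE[OF that(1)] that(2) ext k by (auto simp: extension_at_def)
  ultimately show ?thesis
    by blast
qed

lemma compatible_self:
  assumes "subgroup H G" "extension_at H h"
  shows "compatible H H h h"
  unfolding compatible_def
proof (intro allI ballI)
  fix n y assume y: "y \<in> carrier (coef_at G W H n)"
  have "h n y \<in> carrier (coef_at G I H n)"
    using extension_at_closed[OF assms(2) y] .
  then show "h n (proj_map G W H H n y) = proj_map G I H H n (h n y)"
    using W.proj_map_self[OF assms(1) y] I.proj_map_self[OF assms(1)] by simp
qed

lemma compatible_trans:
  assumes "subgroup H G" "subgroup K G" "subgroup J G" "H \<subseteq> K" "K \<subseteq> J"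
    and "extension_at H h" "compatible H K h k" "compatible K J k j"
  shows "compatible H J h j"
  unfolding compatible_def
proof (intro allI ballI)
  fix n y assume y: "y \<in> carrier (coef_at G W H n)"
  have hy: "h n y \<in> carrier (coef_at G I H n)"
    using extension_at_closed[OF assms(6) y] .
  have "proj_map G W H K n y \<in> carrier (coef_at G W K n)"
    using linear_map_closed[OF W.proj_map_linear[OF assms(1,2,4)] y] .
  then show "j n (proj_map G W H J n y) = proj_map G I H J n (h n y)"
    using W.proj_map_trans[OF assms(1-5) y] I.proj_map_trans[OF assms(1-5) hy] assms(7,8) y
    by (simp add: compatible_def)
qed

lemma extension_at_top:
  obtains h where "extension_at (carrier G) h"
proof (rule extension_step[OF subgroup_self, of "{}" "\<lambda>_. undefined"])
  fix n y
  interpret IG: rat_space "coef_at G I (carrier G) n"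
    by (rule I.rat_space_at[OF subgroup_self])
  show "\<exists>z \<in> carrier (coef_at G I (carrier G) n). \<forall>K \<in> {}.
      undefined n (proj_map G W (carrier G) K n y) = proj_map G I (carrier G) K n z"
    using IG.zero_closed by blast
qed (use that in auto)

lemma extension_along_surjection:
  assumes H: "subgroup H G" and K: "subgroup K G" and "H \<subseteq> K" and k: "extension_at K k"
    and surj: "\<And>n z. z \<in> carrier (coef_at G I K n) \<Longrightarrow>
      \<exists>a \<in> carrier (coef_at G I H n). proj_map G I H K n a = z"
  obtains h where "extension_at H h" "compatible H K h k"
proof (rule extension_step[OF H, of "{K}" "\<lambda>_. k"])
  fix n y assume "y \<in> carrier (coef_at G W H n)"
  then have "proj_map G W H K n y \<in> carrier (coef_at G W K n)"
    by (rule linear_map_closed[OF W.proj_map_linear[OF H K \<open>H \<subseteq> K\<close>]])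
  then obtain a where "a \<in> carrier (coef_at G I H n)"
    "proj_map G I H K n a = k n (proj_map G W H K n y)"
    using surj extension_at_closed[OF k] by blast
  then show "\<exists>z \<in> carrier (coef_at G I H n). \<forall>J \<in> {K}.
      k n (proj_map G W H J n y) = proj_map G I H J n z"
    by (intro bexI[of _ a]) auto
next
  fix h assume "extension_at H h" "\<And>J. J \<in> {K} \<Longrightarrow> compatible H J h k"
  then show thesis
    using that by blast
qed (use K \<open>H \<subseteq> K\<close> k in auto)

text \<open>
  For two incomparable subgroups \<open>P\<close> and \<open>Q\<close> that are the only ones besides \<open>{\<one>}\<close> and \<open>G\<close>, the orbits form
  the square \<open>G/{\<one>} \<rightarrow> G/P, G/Q \<rightarrow> G/G\<close>.  The extension starts at \<open>G/G\<close> and is lifted to \<open>G/P\<close> and to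
  \<open>G/Q\<close> through the surjections onto \<open>I(G/G)\<close>.  The resulting values of an element of \<open>W(G/{\<one>})\<close> in
  \<open>I(G/P)\<close> and \<open>I(G/Q)\<close> agree in \<open>I(G/G)\<close>, so they form an element of the pullback, which
  lifts to \<open>I(G/{\<one>})\<close> by the third surjectivity.
\<close>

lemma extension_if_two_intermediate_subgroups:
  assumes P: "subgroup P G" and Q: "subgroup Q G" and PQ: "\<not> P \<subseteq> Q" "\<not> Q \<subseteq> P"
    and subgroups: "\<And>H. subgroup H G \<Longrightarrow> H \<in> {{\<one>}, P, Q, carrier G}"
    and surj_P: "\<And>n z. z \<in> carrier (coef_at G I (carrier G) n) \<Longrightarrow>
      \<exists>a \<in> carrier (coef_at G I P n). proj_map G I P (carrier G) n a = z"
    and surj_Q: "\<And>n z. z \<in> carrier (coef_at G I (carrier G) n) \<Longrightarrow>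
      \<exists>b \<in> carrier (coef_at G I Q n). proj_map G I Q (carrier G) n b = z"
    and surj_e: "\<And>n a b. \<lbrakk>a \<in> carrier (coef_at G I P n); b \<in> carrier (coef_at G I Q n);
        proj_map G I P (carrier G) n a = proj_map G I Q (carrier G) n b\<rbrakk> \<Longrightarrow>
      \<exists>c \<in> carrier (coef_at G I {\<one>} n).
        proj_map G I {\<one>} P n c = a \<and> proj_map G I {\<one>} Q n c = b"
  shows "\<exists>k. coef_morphism G W I k \<and>
    (\<forall>S \<in> orbits G. \<forall>n. \<forall>x \<in> carrier (cob V S n). k S n (f S n x) = g S n x)"
proof -
  note e = triv_subgroup and top = subgroup_self
  have sub: "{\<one>} \<subseteq> P" "{\<one>} \<subseteq> Q" "P \<subseteq> carrier G" "Q \<subseteq> carrier G"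
    using subgroup.one_closed[OF P] subgroup.one_closed[OF Q] subgroup.subset[OF P]
      subgroup.subset[OF Q] by auto
  have distinct: "P \<noteq> {\<one>}" "Q \<noteq> {\<one>}" "P \<noteq> Q" "P \<noteq> carrier G" "Q \<noteq> carrier G"
    "carrier G \<noteq> {\<one>}"
    using sub PQ by auto
  obtain hG where hG: "extension_at (carrier G) hG"
    by (rule extension_at_top)
  obtain hP where hP: "extension_at P hP" "compatible P (carrier G) hP hG"
    by (rule extension_along_surjection[OF P top sub(3) hG surj_P])
  obtain hQ where hQ: "extension_at Q hQ" "compatible Q (carrier G) hQ hG"
    by (rule extension_along_surjection[OF Q top sub(4) hG surj_Q])
  define k where "k K = (if K = P then hP else hQ)" for K
  have k: "k P = hP" "k Q = hQ"
    using distinct by (auto simp: k_def)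
  obtain he where he: "extension_at {\<one>} he" "compatible {\<one>} P he hP" "compatible {\<one>} Q he hQ"
  proof (rule extension_step[OF e, of "{P, Q}" k])
    fix n y assume y: "y \<in> carrier (coef_at G W {\<one>} n)"
    let ?yP = "proj_map G W {\<one>} P n y" and ?yQ = "proj_map G W {\<one>} Q n y"
    have yPQ: "?yP \<in> carrier (coef_at G W P n)" "?yQ \<in> carrier (coef_at G W Q n)"
      using linear_map_closed[OF W.proj_map_linear[OF e P sub(1)] y]
        linear_map_closed[OF W.proj_map_linear[OF e Q sub(2)] y] by auto
    have "proj_map G I P (carrier G) n (hP n ?yP) = hG n (proj_map G W P (carrier G) n ?yP)"
      using hP(2) yPQ(1) by (simp add: compatible_def)
    also have "\<dots> = hG n (proj_map G W Q (carrier G) n ?yQ)"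
      using W.proj_map_trans[OF e P top sub(1,3) y] W.proj_map_trans[OF e Q top sub(2,4) y] by simp
    also have "\<dots> = proj_map G I Q (carrier G) n (hQ n ?yQ)"
      using hQ(2) yPQ(2) by (simp add: compatible_def)
    finally obtain c where "c \<in> carrier (coef_at G I {\<one>} n)"
      "proj_map G I {\<one>} P n c = hP n ?yP" "proj_map G I {\<one>} Q n c = hQ n ?yQ"
      using surj_e extension_at_closed[OF hP(1) yPQ(1)] extension_at_closed[OF hQ(1) yPQ(2)] by blast
    then show "\<exists>z \<in> carrier (coef_at G I {\<one>} n). \<forall>K \<in> {P, Q}.
        k K n (proj_map G W {\<one>} K n y) = proj_map G I {\<one>} K n z"
      by (intro bexI[of _ c]) (simp_all add: k)
  next
    fix h assume "extension_at {\<one>} h" "\<And>K. K \<in> {P, Q} \<Longrightarrow> compatible {\<one>} K h (k K)"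
    then show thesis
      using that[of h] k by (metis insertCI)
  next
    fix K assume "K \<in> {P, Q}"
    then show "subgroup K G \<and> {\<one>} \<subseteq> K \<and> extension_at K (k K)"
      using P Q sub(1,2) hP(1) hQ(1) k by auto
  qed
  have he_G: "compatible {\<one>} (carrier G) he hG"
    by (rule compatible_trans[OF e P top sub(1,3) he(1,2) hP(2)])
  define h where "h H = (if H = {\<one>} then he else if H = P then hP else if H = Q then hQ else hG)" for H
  have h: "h {\<one>} = he" "h P = hP" "h Q = hQ" "h (carrier G) = hG"
    using distinct by (auto simp: h_def)
  have ext: "extension_at H (h H)" if "subgroup H G" for H
    using subgroups[OF that] he hP hQ hG h by auto
  show ?thesis
  proof (rule extension_morphism[OF ext])
    fix H K assume H: "subgroup H G" and K: "subgroup K G" and "H \<subseteq> K"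
    show "compatible H K (h H) (h K)"
    proof (cases "H = K")
      case True
      then show ?thesis
        using compatible_self[OF K ext[OF K]] by simp
    next
      case False
      have "H \<noteq> carrier G" "K \<noteq> {\<one>}"
        using False \<open>H \<subseteq> K\<close> subgroup.subset[OF K] subgroup.one_closed[OF H] by auto
      then show ?thesis
        using False \<open>H \<subseteq> K\<close> subgroups[OF H] subgroups[OF K] PQ h he he_G hP hQ by auto
    qed
  qed
qed

end

section \<open>Diagrams of DGAs with Property I\<close>

lemma (in dga_diagram) forget_coef_system: "coef_system G (forget A)"
proof
  fix S assume S: "S \<in> orbits G"
  show "graded_vs (cob (forget A) S)"
    using cdga.graded[OF ob[OF S]] by (simp add: forget_def)
next
  fix S T \<phi> n assume "S \<in> orbits G" "T \<in> orbits G" "\<phi> \<in> G_maps G S T"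
  then show "linear_map (cob (forget A) S n) (cob (forget A) T n) (cmor (forget A) S T \<phi> n)"
    using mor by (simp add: forget_def cdga_morphism_def)
qed (simp_all add: forget_def mor_id mor_comp)

lemma structure_map_eq_proj_map: "structure_map G A H K n = proj_map G (forget A) H K n"
  by (simp add: structure_map_def proj_map_def forget_def)

lemma at_orbit_eq_carrier: "at_orbit G A H n = carrier (coef_at G (forget A) H n)"
  by (simp add: at_orbit_def forget_def)

theorem theorem3p2:
  fixes G :: "'g monoid" and P Q :: "'g set" and p q :: nat
    and A :: "('g, 'a) diagram"
  assumes "Factorial_Ring.prime p" and "Factorial_Ring.prime q" and "p \<noteq> q"
    and "group G" and "cyclic_group G" and "Coset.order G = p * q"
    and "subgroup P G" and "card P = p"
    and "subgroup Q G" and "card Q = q"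
    and "dga_diagram G A"
    and "property_I G P Q A"
  shows "injective_coef TYPE('x) TYPE('y) G (forget A)"
proof -
  interpret group G by fact
  interpret comm_group G
    using \<open>cyclic_group G\<close> by (rule cyclic_imp_abelian_group)
  interpret orbit_comm_group G
    by unfold_locales
  have sys: "coef_system G (forget A)"
    using \<open>dga_diagram G A\<close> by (rule dga_diagram.forget_coef_system)
  have fin: "finite (carrier G)"
    using assms(1,2,6) order_gt_0_iff_finite by (simp add: prime_gt_0_nat)
  have "coprime p q" "p \<noteq> 1" "q \<noteq> 1"
    using assms(1-3) primes_coprime by auto
  then have PQ: "\<not> P \<subseteq> Q" "\<not> Q \<subseteq> P"
    using not_subset_of_coprime_card[OF assms(7,9)] not_subset_of_coprime_card[OF assms(9,7)]
      assms(8,10) by (simp_all add: coprime_commute)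
  have surj: "proj_map G (forget A) P (carrier G) n ` carrier (coef_at G (forget A) P n) =
      carrier (coef_at G (forget A) (carrier G) n)"
    "proj_map G (forget A) Q (carrier G) n ` carrier (coef_at G (forget A) Q n) =
      carrier (coef_at G (forget A) (carrier G) n)"
    "map_to_K G P Q A n ` carrier (coef_at G (forget A) {\<one>\<^bsub>G\<^esub>} n) = pullback_K G P Q A n" for n
    using \<open>property_I G P Q A\<close>
    by (simp_all add: property_I_def structure_map_eq_proj_map at_orbit_eq_carrier)
  show ?thesis
    unfolding injective_coef_def
  proof (intro conjI allI impI sys)
    fix V :: "('g, 'x) coef" and W :: "('g, 'y) coef" and f g
    assume *: "coef_system G V \<and> coef_system G W \<and> coef_inj_morphism G V W f \<and>
      coef_morphism G V (forget A) g"
    interpret V: coef_system G V using * by blast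
    interpret W: coef_system G W using * by blast
    interpret I: coef_system G "forget A" by (rule sys)
    interpret extension_problem G V W "forget A" f g
      using * fin by unfold_locales auto
    show "\<exists>h. coef_morphism G W (forget A) h \<and>
      (\<forall>S \<in> orbits G. \<forall>n. \<forall>x \<in> carrier (cob V S n). h S n (f S n x) = g S n x)"
    proof (rule extension_if_two_intermediate_subgroups[OF assms(7,9) PQ])
      show "H \<in> {{\<one>\<^bsub>G\<^esub>}, P, Q, carrier G}" if "subgroup H G" for H
        by (rule subgroups_of_order_pq[OF assms(1-3,6-10) that])
      show "\<exists>a \<in> carrier (coef_at G (forget A) P n).
          proj_map G (forget A) P (carrier G) n a = z"
        if "z \<in> carrier (coef_at G (forget A) (carrier G) n)" for n z
        using that surj(1)[of n] by (metis imageE)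
      show "\<exists>b \<in> carrier (coef_at G (forget A) Q n).
          proj_map G (forget A) Q (carrier G) n b = z"
        if "z \<in> carrier (coef_at G (forget A) (carrier G) n)" for n z
        using that surj(2)[of n] by (metis imageE)
      show "\<exists>c \<in> carrier (coef_at G (forget A) {\<one>\<^bsub>G\<^esub>} n).
          proj_map G (forget A) {\<one>\<^bsub>G\<^esub>} P n c = a \<and> proj_map G (forget A) {\<one>\<^bsub>G\<^esub>} Q n c = b"
        if "a \<in> carrier (coef_at G (forget A) P n)" "b \<in> carrier (coef_at G (forget A) Q n)"
          "proj_map G (forget A) P (carrier G) n a = proj_map G (forget A) Q (carrier G) n b"
        for n a b
      proof -
        have "(a, b) \<in> pullback_K G P Q A n"
          using that by (simp add: pullback_K_def structure_map_eq_proj_map at_orbit_eq_carrier)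
        then obtain c where "c \<in> carrier (coef_at G (forget A) {\<one>\<^bsub>G\<^esub>} n)"
          "(a, b) = map_to_K G P Q A n c"
          using surj(3)[of n] by blast
        then show ?thesis
          by (auto simp: map_to_K_def structure_map_eq_proj_map)
      qed
    qed
  qed
qed

end
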